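(* Consider the two-type frog model on $\mathbb{Z}^d$ ($d\ge 1$) with initial distribution $\nu$, jump probabilities $p_1,p_2$ and an arbitrary tie-breaking rule. For any initial distribution $\nu$ with $\mathbb{P}(\eta(\mathbf{0})\ge 1)>0$, any $p_1,p_2\in(0,1]$ and any $z\in\mathbb{Z}^d\setminus\{\mathbf{0}\}$, conditional on $\eta(\mathbf{0})\geq 1$ and $\eta(z)\geq 1$, we have that $$\mathbb{P}_{\mathbf{0},z}(G_1\cap G_2^c)>0\quad\text{and}\quad \mathbb{P}_{\mathbf{0},z}(G_1^c\cap G_2)>0 .$$
   Context: Two-type frog model on $\mathbb{Z}^d$. Let $\{\eta(x)\}_{x\in\mathbb{Z}^d}$ be i.i.d. random variables with values in $\{0,1,2,\dots\}$; $\eta(x)$ is the initial number of particles at $x$, and $\nu$ denotes the product measure given by this initial particle distribution. Independently, each particle $(x,j)$ ($x\in\mathbb{Z}^d$, $1\le j\le\eta(x)$) has its own independent simple symmetric nearest-neighbour random walk path on $\mathbb{Z}^d$ started at $x$, and an independent family $(L^{x,j}_{n,k})_{n,k}$ of i.i.d. uniform $[0,1]$ variables. At time 0 the particles at the origin $\mathbf{0}$ are active of type 1, the particles at a site $z\neq\mathbf{0}$ are active of type 2, and all other particles are sleeping and have no type. Time is discrete. An active type $i$ particle jumps in each time step independently with probability $p_i$ and otherwise stays put; when it jumps, it moves to the next site of its random walk path. Formally, if particle $(x,j)$, of type $i$, has made $n$ jumps since it was activated and arrived at its current location at time $t$ (with $t$ the activation time if $n=0$), its next jump occurs at time $t+k$,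 where $k\ge 1$ is the smallest integer with $L^{x,j}_{n,k}\le p_i$. A site is discovered when it is first hit by an active particle; it is discovered by type $i$ if a particle of type $i$ is among the first particle(s) hitting it. Sleeping particles at a discovered site are activated at that time and assigned the type of the discovering particle(s). If the site is discovered by both types in the same time step, an arbitrary fixed tie-breaking rule (possibly using additional randomness, e.g. a fair or biased coin toss, a rule based on the number of discovering particles of each type, or always deciding in favour of a given type) decides the type(s) of its particles. Once activated, a particle stays active and keeps its type forever. $\mathbb{P}_{\mathbf{0},z}$ denotes the law of this process, and $G_i$ is the event that infinitely many particles are activated by type $i$ ($i=1,2$); $G_i^c$ is its complement. *)

theory Defs
  imports "HOL-Probability.Probability"
begin

datatype frog_type = Type1 | Type2

type_synonym 'd site = "int ^ 'd"

text \<open>Particle \<open>(x, j)\<close> is the \<open>j\<close>-th particle initially at \<open>x\<close>; it is present iff \<open>1 \<le> j \<le> \<eta> x\<close>.\<close>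
type_synonym 'd particle = "'d site \<times> nat"

text \<open>\<open>Active i y n k\<close>: an active particle of type \<open>i\<close>, located at \<open>y\<close>, that has made \<open>n\<close> jumps
  since its activation and arrived at \<open>y\<close> (or was activated, if \<open>n = 0\<close>) \<open>k\<close> time units ago.\<close>
datatype 'd status = Absent | Sleeping | Active frog_type "'d site" nat nat

type_synonym 'd config = "'d particle \<Rightarrow> 'd status"

text \<open>A sample point \<open>(\<eta>, S, L, u)\<close>: initial particle numbers, random walk increments, the variables
  \<open>L((x,j),n,k)\<close> governing the waiting times, and the additional randomness \<open>u\<close> that the
  tie-breaking rule may use.\<close>
type_synonym ('d, 'u) sample =
  "('d site \<Rightarrow> nat) \<times> ('d particle \<times> nat \<Rightarrow> 'd site) \<times> ('d particle \<times> nat \<times> nat \<Rightarrow> real) \<times> 'u"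

definition unit_steps :: "(int ^ 'd::finite) set" where
  "unit_steps = {axis a 1 | a. True} \<union> {axis a (- 1) | a. True}"

text \<open>Here \<open>\<nu>\<close> is the law of a single \<open>\<eta> x\<close>.\<close>
definition frog_space :: "nat pmf \<Rightarrow> 'u measure \<Rightarrow> ('d::finite, 'u) sample measure" where
  "frog_space \<nu> N =
     (\<Pi>\<^sub>M x\<in>UNIV. measure_pmf \<nu>)
     \<Otimes>\<^sub>M (\<Pi>\<^sub>M qn\<in>UNIV. measure_pmf (pmf_of_set unit_steps))
     \<Otimes>\<^sub>M (\<Pi>\<^sub>M qnk\<in>UNIV. uniform_measure lborel {0..1})
     \<Otimes>\<^sub>M N"

definition initial_number :: "('d::finite, 'u) sample \<Rightarrow> 'd site \<Rightarrow> nat" where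
  "initial_number = (\<lambda>(\<eta>, S, L, u). \<eta>)"

definition walk_path :: "('d::finite particle \<times> nat \<Rightarrow> 'd site) \<Rightarrow> 'd particle \<Rightarrow> nat \<Rightarrow> 'd site" where
  "walk_path S q n = fst q + (\<Sum>m<n. S (q, m))"

definition initial_config :: "('d::finite site \<Rightarrow> nat) \<Rightarrow> 'd site \<Rightarrow> 'd config" where
  "initial_config \<eta> z = (\<lambda>(x, j).
     if 1 \<le> j \<and> j \<le> \<eta> x then
       (if x = 0 then Active Type1 x 0 0 else if x = z then Active Type2 x 0 0 else Sleeping)
     else Absent)"

text \<open>The jumps of one time step. Since the counter \<open>k\<close> increases by one until the first success, the
  jump following an arrival occurs after the smallest \<open>k \<ge> 1\<close> with \<open>L (q, n, k) \<le> p i\<close>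
  (and never if there is no such \<open>k\<close>).\<close>
definition move_config ::
  "(frog_type \<Rightarrow> real) \<Rightarrow> ('d::finite particle \<times> nat \<Rightarrow> 'd site) \<Rightarrow>
   ('d particle \<times> nat \<times> nat \<Rightarrow> real) \<Rightarrow> 'd config \<Rightarrow> 'd config" where
  "move_config p S L c = (\<lambda>q. case c q of
       Active i y n k \<Rightarrow>
         (if L (q, n, Suc k) \<le> p i then Active i (walk_path S q (Suc n)) (Suc n) 0
          else Active i y n (Suc k))
     | s \<Rightarrow> s)"

definition occupied_by :: "frog_type \<Rightarrow> 'd site \<Rightarrow> 'd config \<Rightarrow> bool" where
  "occupied_by i x c \<longleftrightarrow> (\<exists>q n k. c q = Active i x n k)"

text \<open>The activations of one time step, where \<open>c\<close> is the configuration after the jumps and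
  \<open>\<tau> x j\<close> is the verdict of the tie-breaking rule for particle \<open>(x, j)\<close>. A site that
  still carries sleeping particles has not been hit before, so the active particles
  now at that site are exactly those discovering it.\<close>
definition activate_config :: "('d site \<Rightarrow> nat \<Rightarrow> frog_type) \<Rightarrow> 'd config \<Rightarrow> 'd config" where
  "activate_config \<tau> c = (\<lambda>(x, j). case c (x, j) of
       Sleeping \<Rightarrow>
         (if occupied_by Type1 x c \<and> occupied_by Type2 x c then Active (\<tau> x j) x 0 0
          else if occupied_by Type1 x c then Active Type1 x 0 0
          else if occupied_by Type2 x c then Active Type2 x 0 0
          else Sleeping)
     | s \<Rightarrow> s)"

text \<open>A tie-breaking rule: \<open>tie u t h c x j\<close> is the type given to particle \<open>(x, j)\<close> if \<open>x\<close> is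
  discovered by both types at time \<open>t + 1\<close>. It may depend on the additional randomness \<open>u\<close>, on the
  history \<open>h\<close> of the configurations at the times \<open>0, \<dots>, t\<close>, and on the configuration \<open>c\<close>
  resulting from the jumps at time \<open>t + 1\<close> (which shows the discovering particles).\<close>
type_synonym ('d, 'u) tie_rule =
  "'u \<Rightarrow> nat \<Rightarrow> (nat \<Rightarrow> 'd config) \<Rightarrow> 'd config \<Rightarrow> 'd site \<Rightarrow> nat \<Rightarrow> frog_type"

definition config_space :: "'d config measure" where
  "config_space = (\<Pi>\<^sub>M q\<in>UNIV. count_space UNIV)"

definition tie_breaking_rule :: "'u measure \<Rightarrow> ('d::finite, 'u) tie_rule \<Rightarrow> bool" where
  "tie_breaking_rule N tie \<longleftrightarrow>
     (\<forall>t x j. (\<lambda>(u, h, c). tie u t h c x j)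
        \<in> N \<Otimes>\<^sub>M (\<Pi>\<^sub>M s\<in>{..t}. config_space) \<Otimes>\<^sub>M config_space \<rightarrow>\<^sub>M count_space UNIV)"

text \<open>\<open>frog_history p tie z \<omega> t\<close> is the map \<open>s \<mapsto> \<xi>\<^sub>s\<close> on \<open>{0, \<dots>, t}\<close>, where \<open>\<xi>\<^sub>s\<close> is the
  configuration at time \<open>s\<close>.\<close>
fun frog_history ::
  "(frog_type \<Rightarrow> real) \<Rightarrow> ('d::finite, 'u) tie_rule \<Rightarrow> 'd site \<Rightarrow> ('d, 'u) sample \<Rightarrow> nat \<Rightarrow>
   nat \<Rightarrow> 'd config" where
  "frog_history p tie z (\<eta>, S, L, u) 0 = (\<lambda>s\<in>{..0}. initial_config \<eta> z)"
| "frog_history p tie z (\<eta>, S, L, u) (Suc t) =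
     (let h = frog_history p tie z (\<eta>, S, L, u) t;
          c = move_config p S L (h t)
      in h(Suc t := activate_config (tie u t h c) c))"

definition frog_process ::
  "(frog_type \<Rightarrow> real) \<Rightarrow> ('d::finite, 'u) tie_rule \<Rightarrow> 'd site \<Rightarrow> ('d, 'u) sample \<Rightarrow> nat \<Rightarrow> 'd config"
  where "frog_process p tie z \<omega> t = frog_history p tie z \<omega> t t"

definition activated_by ::
  "(frog_type \<Rightarrow> real) \<Rightarrow> ('d::finite, 'u) tie_rule \<Rightarrow> 'd site \<Rightarrow> frog_type \<Rightarrow> ('d, 'u) sample \<Rightarrow>
   'd particle set" where
  "activated_by p tie z i \<omega> = {q. \<exists>t y n k. frog_process p tie z \<omega> t q = Active i y n k}"

text \<open>The event \<open>G\<^sub>i\<close>. The finitely many particles active at time 0 are included in \<open>activated_by\<close>, which does not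
  affect infinitude.\<close>
definition infinite_growth ::
  "(frog_type \<Rightarrow> real) \<Rightarrow> ('d::finite, 'u) tie_rule \<Rightarrow> 'd site \<Rightarrow> frog_type \<Rightarrow> ('d, 'u) sample \<Rightarrow> bool"
  where "infinite_growth p tie z i \<omega> \<longleftrightarrow> infinite (activated_by p tie z i \<omega>)"

end

theory Submission
  imports Defs "HOL-Real_Asymp.Real_Asymp"
begin

text \<open>Let \<open>w\<close> be the starting site of the type that is meant to win and \<open>l\<close> that of the other type.
  With positive probability a single particle from \<open>w\<close> sweeps a large cube of radius \<open>R\<close> around \<open>w\<close>
  while all particles of the losing type merely jump back and forth between \<open>l\<close> and a neighbour \<open>l'\<close>.
  This event involves finitely many coordinates, and it is independent of the following one, which has
  positive probability for large \<open>R\<close>.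

  Once the cube of radius \<open>\<rho>\<close> is discovered, each site of the next shell is hit
  within about \<open>sqrt \<rho>\<close> jumps by one of the particles lying inwards of it: the expected number of such
  particles is the expected number of sites visited by a walk in an orthant, hence at least of order
  \<open>\<rho> powr (1/4)\<close>, and the particles are independent, so failures have stretched-exponentially small
  probability. If in addition no waiting time exceeds about \<open>\<rho> powr (1/8)\<close>, then the discovered cube has radius
  \<open>\<rho>\<close> after time \<open>O(\<rho> powr (13/8))\<close>. Since \<open>13/8 < 2\<close>, a Chernoff bound shows that the finitely many losing
  particles, which move diffusively, never leave the discovered cube.\<close>

section \<open>Deterministic growth\<close>

text \<open>The losing type may be the faster one and ties may be decided by any rule that sees the
  history, so its clocks are left uncontrolled: a losing particle is only known to have made at most
  \<open>t\<close> jumps by time \<open>t\<close>. Hence its walk is confined as a function of the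
  number of jumps, and the favourable event involves only particle numbers, increments, and waiting
  variables compared with the winner's jump probability. On this event the conclusion is
  deterministic: the losing type meets no sleepers outside \<open>{l, l'}\<close>. The particles at
  \<open>l'\<close> may receive either type and are confined like losers in any case.

  Independence comes from disjoint coordinates. After the sweep, only particles starting outside the
  cube of half the current radius have to spread, and none of these starts at \<open>w\<close>,
  \<open>l\<close> or \<open>l'\<close>; the losers are then constrained only in their increments
  from number \<open>M0\<close> on.

  The exponents leave room. Hits and waiting times need positive powers of \<open>\<rho>\<close> so
  that failures are summable, and a shell must be completed in time of order
  \<open>\<rho> powr c\<close> with \<open>c < 1\<close>, so that the total time stays below order
  \<open>\<rho>\<close> squared; here \<open>c = 5/8\<close>.\<close>

fun other_type :: "frog_type \<Rightarrow> frog_type" where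
  "other_type Type1 = Type2" | "other_type Type2 = Type1"

lemma type_cases: "j = i \<or> j = other_type i"
  by (cases i; cases j) auto

lemma other_type_neq [simp]: "other_type i \<noteq> i" "i \<noteq> other_type i"
  by (cases i; simp)+

definition cube :: "'d::finite site \<Rightarrow> nat \<Rightarrow> 'd site set" where
  "cube w \<rho> = {x. \<forall>j. \<bar>x $ j - w $ j\<bar> \<le> int \<rho>}"

text \<open>The cardinality of this set orders the sites within one new shell: points on faces,
  edges and corners have more and more such coordinates, and a site is hit from a site that has
  strictly fewer.\<close>

definition outside :: "'d::finite site \<Rightarrow> nat \<Rightarrow> 'd site \<Rightarrow> 'd set" where
  "outside w \<rho> x = {j. \<bar>x $ j - w $ j\<bar> > int \<rho>}"

lemma outside_empty_iff: "outside w \<rho> x = {} \<longleftrightarrow> x \<in> cube w \<rho>"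
  by (auto simp: outside_def cube_def not_less)

lemma cube_mono: "\<rho> \<le> \<sigma> \<Longrightarrow> cube w \<rho> \<subseteq> cube w \<sigma>"
  unfolding cube_def by (auto intro: order_trans)

text \<open>The verdicts \<open>\<tau>\<close> are arbitrary functions, so whatever is proved here
  holds for every tie-breaking rule. The starting sites are called \<open>w\<close> and
  \<open>l\<close> and the types \<open>i\<close> and \<open>other_type i\<close>, so that both
  claims of the theorem become instances.\<close>

locale frog_run =
  fixes p :: "frog_type \<Rightarrow> real" and S :: "'d::finite particle \<times> nat \<Rightarrow> 'd site"
    and L :: "'d particle \<times> nat \<times> nat \<Rightarrow> real" and \<eta> :: "'d site \<Rightarrow> nat"
    and \<xi> :: "nat \<Rightarrow> 'd config" and \<tau> :: "nat \<Rightarrow> 'd site \<Rightarrow> nat \<Rightarrow> frog_type"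
    and w l :: "'d site" and i :: frog_type
  assumes start: "\<xi> 0 = (\<lambda>(x, j). if 1 \<le> j \<and> j \<le> \<eta> x then
       (if x = w then Active i x 0 0 else if x = l then Active (other_type i) x 0 0 else Sleeping)
     else Absent)"
    and step: "\<xi> (Suc t) = activate_config (\<tau> t) (move_config p S L (\<xi> t))"
begin

text \<open>Configurations do not record discovery. A site without particles is awake from the
  start, which is harmless because only the absence of sleepers is used.\<close>

definition awake :: "nat \<Rightarrow> 'd site \<Rightarrow> bool" where
  "awake t x \<longleftrightarrow> (\<forall>j. \<xi> t (x, j) \<noteq> Sleeping)"

lemma absent_iff: "\<xi> t (x, j) = Absent \<longleftrightarrow> \<not> (1 \<le> j \<and> j \<le> \<eta> x)"
proof (induction t)
  case 0
  then show ?case by (auto simp: start)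
next
  case (Suc t)
  then show ?case
    by (auto simp: step activate_config_def move_config_def split: status.splits)
qed

lemma not_sleeping_Suc: "\<xi> t q \<noteq> Sleeping \<Longrightarrow> \<xi> (Suc t) q \<noteq> Sleeping"
  by (cases q) (auto simp: step activate_config_def move_config_def split: status.splits)

lemma awake_mono: "awake s x \<Longrightarrow> s \<le> t \<Longrightarrow> awake t x"
proof (induction t)
  case (Suc t)
  then show ?case by (cases "s = Suc t") (auto simp: awake_def not_sleeping_Suc)
qed simp

lemma active_Suc:
  assumes "\<xi> t q = Active j y n k"
  shows "\<xi> (Suc t) q = (if L (q, n, Suc k) \<le> p j then Active j (walk_path S q (Suc n)) (Suc n) 0
          else Active j y n (Suc k))"
  using assms by (cases q) (auto simp: step activate_config_def move_config_def)

text \<open>The bound \<open>n \<le> t\<close> is the only information about the clocks of losing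
  particles that enters the proof.\<close>

lemma active_position:
  "\<xi> t q = Active j y n k \<Longrightarrow> y = walk_path S q n \<and> n \<le> t"
proof (induction t arbitrary: j y n k)
  case 0
  then show ?case by (cases q) (auto simp: start walk_path_def split: if_splits)
next
  case (Suc t)
  show ?case
  proof (cases "\<xi> t q")
    case (Active j' y' n' k')
    with Suc.IH[OF Active] Suc.prems active_Suc[OF Active] show ?thesis by (auto split: if_splits)
  next
    case Absent
    with Suc.prems show ?thesis
      by (cases q) (auto simp: step activate_config_def move_config_def)
  next
    case Sleeping
    with Suc.prems show ?thesis
      by (cases q) (auto simp: step activate_config_def move_config_def walk_path_def split: if_splits)
  qed
qed

lemma awakening:
  assumes "\<xi> t (x, j) = Active a y n k"
  obtains s b where "s \<le> t" "\<xi> s (x, j) = Active b x 0 0"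
  using assms
proof (induction t arbitrary: a y n k thesis)
  case 0
  then show ?case by (auto simp: start split: if_splits)
next
  case (Suc t)
  show ?case
  proof (cases "\<xi> t (x, j)")
    case (Active j' y' n' k')
    show ?thesis
    proof (rule Suc.IH[OF _ Active])
      fix s b assume "s \<le> t" "\<xi> s (x, j) = Active b x 0 0"
      then show thesis by (intro Suc.prems(1)[of s b]) auto
    qed
  next
    case Absent
    with Suc.prems(2) show ?thesis by (auto simp: step activate_config_def move_config_def)
  next
    case Sleeping
    with Suc.prems(2) have "\<exists>b. \<xi> (Suc t) (x, j) = Active b x 0 0"
      by (auto simp: step activate_config_def move_config_def split: if_splits)
    with Suc.prems(1) show ?thesis by blast
  qed
qed

text \<open>A particle that is active at \<open>x\<close> after a time step either stood there after
  the jumps or was woken by one that did. In both cases \<open>x\<close> is occupied when the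
  activations take place, and all its sleepers wake up.\<close>

lemma active_awake:
  assumes "\<xi> t q = Active a x n k"
  shows "awake t x"
proof (cases t)
  case 0
  with assms show ?thesis by (cases q) (auto simp: start awake_def split: if_splits)
next
  case (Suc s)
  let ?c = "move_config p S L (\<xi> s)"
  have "\<exists>b. occupied_by b x ?c"
  proof (cases "\<xi> s q")
    case (Active j' y' n' k')
    with assms Suc have "\<exists>n k. ?c q = Active a x n k"
      using active_Suc[OF Active] by (auto simp: move_config_def split: if_splits)
    then show ?thesis unfolding occupied_by_def by blast
  next
    case Absent
    with assms Suc show ?thesis by (cases q) (auto simp: step activate_config_def move_config_def)
  next
    case Sleeping
    with assms Suc show ?thesis
      by (cases q) (auto simp: step activate_config_def move_config_def split: if_splits)
  qed
  then obtain b where "occupied_by b x ?c" by blast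
  then have "occupied_by Type1 x ?c \<or> occupied_by Type2 x ?c" by (cases b) auto
  then show ?thesis
    by (auto simp: awake_def Suc step activate_config_def split: status.splits)
qed

lemma waiting:
  assumes "\<xi> t q = Active a y m 0" "\<exists>k\<in>{1..K}. L (q, m, k) \<le> p a"
  shows "\<exists>s\<le>t + K. \<xi> s q = Active a (walk_path S q (Suc m)) (Suc m) 0"
proof -
  \<comment> \<open>This is the actual waiting time; by minimality the counter runs undisturbed up
    to \<open>k - 1\<close>.\<close>
  define k where "k = (LEAST k. 1 \<le> k \<and> L (q, m, k) \<le> p a)"
  from assms(2) obtain k0 where k0: "1 \<le> k0 \<and> L (q, m, k0) \<le> p a" "k0 \<le> K" by auto
  have k: "1 \<le> k" "L (q, m, k) \<le> p a"
    unfolding k_def using LeastI[of "\<lambda>k. 1 \<le> k \<and> L (q, m, k) \<le> p a", OF k0(1)] by auto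
  have "k \<le> K" unfolding k_def using Least_le[of "\<lambda>k. 1 \<le> k \<and> L (q, m, k) \<le> p a", OF k0(1)] k0(2)
    by simp
  have min: "\<not> L (q, m, k') \<le> p a" if "1 \<le> k'" "k' < k" for k'
    using that not_less_Least unfolding k_def by blast
  have "\<xi> (t + r) q = Active a y m r" if "r < k" for r
    using that
  proof (induction r)
    case (Suc r)
    then have "\<xi> (t + r) q = Active a y m r" by simp
    from active_Suc[OF this] min[of "Suc r"] Suc.prems show ?case by simp
  qed (use assms in simp)
  from this[of "k - 1"] k(1) have "\<xi> (t + (k - 1)) q = Active a y m (k - 1)" by simp
  from active_Suc[OF this] k have "\<xi> (t + k) q = Active a (walk_path S q (Suc m)) (Suc m) 0"
    by simp
  with \<open>k \<le> K\<close> show ?thesis by (intro exI[of _ "t + k"]) simp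
qed

lemma reaching:
  assumes "\<xi> t q = Active a y 0 0" "\<And>m. m < n \<Longrightarrow> \<exists>k\<in>{1..K}. L (q, m, k) \<le> p a" "m \<le> n"
  shows "\<exists>s\<le>t + m * K. \<exists>y. \<xi> s q = Active a y m 0"
  using assms(3)
proof (induction m)
  case 0
  with assms show ?case by auto
next
  case (Suc m)
  then obtain s y where s: "s \<le> t + m * K" "\<xi> s q = Active a y m 0" by auto
  from waiting[OF s(2) assms(2)] Suc.prems obtain s'
    where "s' \<le> s + K" "\<xi> s' q = Active a (walk_path S q (Suc m)) (Suc m) 0" by auto
  with s(1) show ?case by (intro exI[of _ s']) auto
qed

end

text \<open>\<open>n \<rho>\<close> and \<open>K \<rho>\<close> bound the numbers of jumps and the waiting times after which a site adjacent to
  the discovered region is hit. A site of the next shell is reached by decreasing the number of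
  coordinates outside the old cube one at a time, whence the factor \<open>CARD('d)\<close>.\<close>
locale frog_win = frog_run p S L \<eta> \<xi> \<tau> w l i
  for p :: "frog_type \<Rightarrow> real" and S :: "'d::finite particle \<times> nat \<Rightarrow> 'd site" and L \<eta> \<xi> \<tau> w l i +
  fixes l' :: "'d site" and M0 R0 :: nat and n K :: "nat \<Rightarrow> nat"
  assumes w_neq: "w \<noteq> l" "w \<noteq> l'"
    and occupied_w: "1 \<le> \<eta> w"
    and cover: "\<And>x. x \<in> cube w R0 \<Longrightarrow> \<exists>m\<le>M0. walk_path S (w, 1) m = x"
    and no_wait: "\<And>m. m < M0 \<Longrightarrow> L ((w, 1), m, 1) \<le> p i"
    and loser_early: "\<And>x j m. x \<in> {l, l'} \<Longrightarrow> 1 \<le> j \<Longrightarrow> j \<le> \<eta> x \<Longrightarrow> m \<le> M0 \<Longrightarrow>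
          walk_path S (x, j) m \<in> {l, l'}"
    and loser_late: "\<And>x j m \<rho>. x \<in> {l, l'} \<Longrightarrow> 1 \<le> j \<Longrightarrow> j \<le> \<eta> x \<Longrightarrow> R0 \<le> \<rho> \<Longrightarrow> M0 < m \<Longrightarrow>
          m \<le> M0 + (\<Sum>r=R0..\<rho>. CARD('d) * (n r * K r)) \<Longrightarrow>
          walk_path S (x, j) m \<in> cube w \<rho>"
    and loser_cube: "l \<in> cube w (R0 div 2)" "l' \<in> cube w (R0 div 2)"
    and spread: "\<And>\<rho> x. R0 \<le> \<rho> \<Longrightarrow> x \<in> cube w (Suc \<rho>) \<Longrightarrow> x \<notin> cube w \<rho> \<Longrightarrow>
          \<exists>y m. y \<in> cube w (Suc \<rho>) \<and> y \<notin> cube w (\<rho> div 2) \<and> 1 \<le> \<eta> y \<and> outside w \<rho> y \<subset> outside w \<rho> x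
            \<and> m \<le> n \<rho> \<and> walk_path S (y, 1) m = x
            \<and> (\<forall>m<n \<rho>. \<exists>k\<in>{1..K \<rho>}. L ((y, 1), m, k) \<le> p i)"
    and nK: "\<And>\<rho>. R0 \<le> \<rho> \<Longrightarrow> 1 \<le> n \<rho> * K \<rho>"
begin

definition contained :: "nat \<Rightarrow> bool" where
  "contained t \<longleftrightarrow> (\<forall>s\<le>t. \<forall>x j y m k. \<xi> s (x, j) = Active (other_type i) y m k \<longrightarrow> x \<in> {l, l'})"

lemma containedD: "contained t \<Longrightarrow> s \<le> t \<Longrightarrow> \<xi> s (x, j) = Active (other_type i) y m k \<Longrightarrow> x \<in> {l, l'}"
  unfolding contained_def by blast

lemma contained_antimono: "contained t \<Longrightarrow> s \<le> t \<Longrightarrow> contained s"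
  unfolding contained_def by (meson le_trans)

text \<open>Deadline by which the cube of radius \<open>\<rho>\<close> is free of sleepers:
  \<open>M0\<close> steps for the sweep, then \<open>CARD('d)\<close> rounds for each further
  shell.\<close>

definition T :: "nat \<Rightarrow> nat" where
  "T \<rho> = M0 + (\<Sum>r=R0..<\<rho>. CARD('d) * (n r * K r))"

lemma T_Suc: "R0 \<le> \<rho> \<Longrightarrow> T (Suc \<rho>) = T \<rho> + CARD('d) * (n \<rho> * K \<rho>)"
  by (simp add: T_def)

lemma T_R0: "T R0 = M0"
  by (simp add: T_def)

lemma T_unbounded: "\<rho> \<le> T (R0 + \<rho>)"
proof (induction \<rho>)
  case (Suc \<rho>)
  have "0 < CARD('d) * (n (R0 + \<rho>) * K (R0 + \<rho>))"
    using nK[of "R0 + \<rho>"] by (simp add: Suc_le_eq)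
  with Suc T_Suc[OF le_add1, of \<rho>] show ?case
    by (simp only: add_Suc_right)
qed simp

text \<open>The particle at \<open>y\<close> is present and no longer asleep, so it was woken at
  some time, and containment rules out the losing type. Knowing its type matters because the waiting
  times are controlled only relative to \<open>p i\<close>.\<close>

lemma winner_active:
  assumes "contained t" "awake t y" "1 \<le> \<eta> y" "y \<notin> {l, l'}"
  shows "\<exists>s\<le>t. \<xi> s (y, 1) = Active i y 0 0"
proof -
  have "\<xi> t (y, 1) \<noteq> Absent" "\<xi> t (y, 1) \<noteq> Sleeping"
    using absent_iff[of t y 1] assms by (auto simp: awake_def)
  then obtain a y' m k where "\<xi> t (y, 1) = Active a y' m k" by (cases "\<xi> t (y, 1)") auto
  then obtain s b where s: "s \<le> t" "\<xi> s (y, 1) = Active b y 0 0" by (rule awakening)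
  then have "b = i"
    using containedD[OF assms(1)] assms(4) type_cases[of b i] by blast
  with s show ?thesis by blast
qed

text \<open>The induction on the radius has an inner induction on the number of coordinates outside
  the old cube. Containment is assumed up to the deadline only, which lets this lemma be used inside
  the induction that proves containment.\<close>

lemma cube_awake:
  assumes "R0 \<le> \<rho>"
  shows "x \<in> cube w \<rho> \<Longrightarrow> contained (T \<rho>) \<Longrightarrow> awake (T \<rho>) x"
  using assms
proof (induction \<rho> arbitrary: x rule: dec_induct)
  case base
  from cover[OF base(1)] obtain m where m: "m \<le> M0" "walk_path S (w, 1) m = x" by blast
  have "\<xi> 0 (w, 1) = Active i w 0 0" using occupied_w by (simp add: start)
  from reaching[OF this, of M0 1 m] no_wait m(1) obtain s y where
    s: "s \<le> m" "\<xi> s (w, 1) = Active i y m 0" by auto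
  with active_position[OF s(2)] m active_awake[OF s(2)] awake_mono T_R0 show ?case by auto
next
  case (step \<rho>)
  have cont: "contained (T \<rho>)" using step.prems(2) T_Suc[OF step.hyps(1)] contained_antimono by simp
  \<comment> \<open>Round \<open>k\<close> handles the sites with at most \<open>k\<close> outside
    coordinates, each hit from a site settled one round earlier. The restriction
    \<open>k \<le> CARD('d)\<close> keeps all times below \<open>T (Suc \<rho>)\<close>, where
    containment is available.\<close>
  have *: "awake (T \<rho> + k * (n \<rho> * K \<rho>)) x"
    if "x \<in> cube w (Suc \<rho>)" "card (outside w \<rho> x) \<le> k" "k \<le> CARD('d)" for x k
    using that
  proof (induction k arbitrary: x)
    case 0
    then have "x \<in> cube w \<rho>" by (simp add: outside_empty_iff)
    with step.IH cont show ?case by simp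
  next
    case (Suc k)
    show ?case
    proof (cases "x \<in> cube w \<rho>")
      case True
      with step.IH cont awake_mono show ?thesis by (meson le_add1)
    next
      case False
      from spread[OF step.hyps(1) Suc.prems(1) False] obtain y m where
        y: "y \<in> cube w (Suc \<rho>)" "y \<notin> cube w (\<rho> div 2)" "1 \<le> \<eta> y" "outside w \<rho> y \<subset> outside w \<rho> x"
        "m \<le> n \<rho>" "walk_path S (y, 1) m = x"
        and wait: "\<And>m. m<n \<rho> \<Longrightarrow> \<exists>k\<in>{1..K \<rho>}. L ((y, 1), m, k) \<le> p i" by blast
      let ?t = "T \<rho> + k * (n \<rho> * K \<rho>)"
      from y(4) have "card (outside w \<rho> y) < card (outside w \<rho> x)"
        by (intro psubset_card_mono) auto
      with Suc.prems have "awake ?t y" by (intro Suc.IH y) auto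
      moreover have "y \<notin> {l, l'}"
        using y(2) loser_cube cube_mono[of "R0 div 2" "\<rho> div 2"] step.hyps(1) by (auto simp: div_le_mono)
      moreover have "contained ?t"
      proof -
        have "?t \<le> T (Suc \<rho>)" using T_Suc[OF step.hyps(1)] Suc.prems(3) by (simp del: mult_Suc)
        with step.prems(2) show ?thesis by (rule contained_antimono)
      qed
      ultimately obtain s where s: "s \<le> ?t" "\<xi> s (y, 1) = Active i y 0 0"
        using winner_active y(3) by blast
      from reaching[OF s(2) wait y(5)] obtain s' y' where
        s': "s' \<le> s + m * K \<rho>" "\<xi> s' (y, 1) = Active i y' m 0" by auto
      have "awake s' x" using active_awake[OF s'(2)] active_position[OF s'(2)] y(6) by simp
      moreover have "s' \<le> T \<rho> + Suc k * (n \<rho> * K \<rho>)"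
        using s'(1) s(1) mult_le_mono1[OF y(5), of "K \<rho>"] unfolding mult_Suc by linarith
      ultimately show ?thesis by (rule awake_mono)
    qed
  qed
  have "card (outside w \<rho> x) \<le> CARD('d)" by (intro card_mono) auto
  from *[OF step.prems(1) this] show ?case using T_Suc[OF step.hyps(1)] by simp
qed

text \<open>Types are permanent, so only a sleeper woken at time \<open>Suc t\<close> could break
  containment. The losing particle waking it starts in \<open>{l, l'}\<close> by the induction
  hypothesis. With at most \<open>M0\<close> jumps it is still on \<open>{l, l'}\<close>; with more
  jumps it lies in a cube that \<open>cube_awake\<close>, applied up to a time at most
  \<open>t\<close>, shows to be free of sleepers. Growth and containment thus support each other
  without circularity.\<close>

lemma contained: "contained t"
proof (induction t)
  case 0
  show ?case by (auto simp: contained_def start split: if_splits)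
next
  case (Suc t)
  have "fst q \<in> {l, l'}" if q: "\<xi> (Suc t) q = Active (other_type i) y m k" for q y m k
  proof (cases "\<xi> t q")
    case (Active j' y' n' k')
    with q have "j' = other_type i" using active_Suc[OF Active] by (auto split: if_splits)
    with Active Suc show ?thesis using containedD[of t t "fst q" "snd q"] by simp
  next
    case Absent
    with q show ?thesis by (cases q) (auto simp: step activate_config_def move_config_def)
  next
    case Sleeping
    obtain x j where qx: "q = (x, j)" by (cases q)
    have "occupied_by (other_type i) x (move_config p S L (\<xi> t))"
      using q Sleeping unfolding qx
      by (cases i) (auto simp: step activate_config_def move_config_def split: if_splits)
    then obtain q' n' k' where q': "move_config p S L (\<xi> t) q' = Active (other_type i) x n' k'"
      by (auto simp: occupied_by_def)
    obtain x' j' where qx': "q' = (x', j')" by (cases q')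
    have "\<exists>y n k. \<xi> t q' = Active (other_type i) y n k"
      using q' by (auto simp: move_config_def split: status.splits if_splits)
    then have loser: "x' \<in> {l, l'}" "1 \<le> j'" "j' \<le> \<eta> x'"
      using containedD[OF Suc order_refl] absent_iff[of t x' j'] unfolding qx' by fastforce+
    have "\<xi> (Suc t) q' = Active (other_type i) x n' k'"
      using q' by (simp add: step activate_config_def qx')
    then have pos: "x = walk_path S q' n'" "n' \<le> Suc t"
      using active_position by blast+
    have late: "x \<in> cube w \<rho>" if "R0 \<le> \<rho>" "M0 < n'" "n' \<le> T (Suc \<rho>)" for \<rho>
      using loser_late[of x' j' \<rho> n'] loser pos that
      by (simp add: T_def qx' atLeastLessThanSuc_atLeastAtMost)
    show ?thesis
    proof (cases "n' \<le> M0")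
      case True
      with loser_early[OF loser, of n'] pos qx qx' show ?thesis by simp
    next
      case False
      with pos have "T R0 \<le> t" by (simp add: T_R0)
      \<comment> \<open>The last stage completed by time \<open>t\<close>; it exists because the
        deadlines are unbounded.\<close>
      define \<rho> where "\<rho> = (GREATEST \<rho>. R0 \<le> \<rho> \<and> T \<rho> \<le> t)"
      have bound: "\<rho> \<le> R0 + t" if "R0 \<le> \<rho> \<and> T \<rho> \<le> t" for \<rho>
        using T_unbounded[of "\<rho> - R0"] that by (simp add: le_diff_conv)
      have \<rho>: "R0 \<le> \<rho>" "T \<rho> \<le> t"
        unfolding \<rho>_def
        using GreatestI_nat[of "\<lambda>\<rho>. R0 \<le> \<rho> \<and> T \<rho> \<le> t" R0 "R0 + t"] bound \<open>T R0 \<le> t\<close> by auto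
      \<comment> \<open>Equivalently \<open>Suc t \<le> T (Suc \<rho>)\<close>, which absorbs the
        extra unit in \<open>n' \<le> Suc t\<close> and makes \<open>loser_late\<close> applicable
        at radius \<open>\<rho>\<close>.\<close>
      have "\<not> T (Suc \<rho>) \<le> t"
        using Greatest_le_nat[of "\<lambda>\<rho>. R0 \<le> \<rho> \<and> T \<rho> \<le> t" "Suc \<rho>" "R0 + t"] bound \<rho>(1)
        unfolding \<rho>_def[symmetric] by auto
      with pos False have "x \<in> cube w \<rho>" by (intro late \<rho>) auto
      with \<rho> Suc have "awake (T \<rho>) x" by (intro cube_awake contained_antimono[OF Suc])
      from awake_mono[OF this \<rho>(2)] have "awake t x" .
      with Sleeping show ?thesis by (simp add: awake_def qx)
    qed
  qed
  with Suc show ?case unfolding contained_def by (metis fst_conv le_Suc_eq)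
qed

theorem loser_finite: "finite {q. \<exists>t y n k. \<xi> t q = Active (other_type i) y n k}"
proof (rule finite_subset)
  show "{q. \<exists>t y n k. \<xi> t q = Active (other_type i) y n k} \<subseteq> {l, l'} \<times> {..max (\<eta> l) (\<eta> l')}"
  proof
    fix q assume "q \<in> {q. \<exists>t y n k. \<xi> t q = Active (other_type i) y n k}"
    then obtain x j t y m k where *: "\<xi> t (x, j) = Active (other_type i) y m k" and q: "q = (x, j)"
      by (cases q) auto
    then have "x \<in> {l, l'}" using containedD[OF contained order_refl] by blast
    with * absent_iff[of t x j] show "q \<in> {l, l'} \<times> {..max (\<eta> l) (\<eta> l')}"
      by (auto simp: q)
  qed
qed auto

text \<open>Finitely many activated particles would all start in one cube. Applied at twice its
  radius or more, \<open>spread\<close> yields an occupied site outside that cube, and the first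
  particle there is activated by type \<open>i\<close>.\<close>

theorem winner_infinite: "infinite {q. \<exists>t y n k. \<xi> t q = Active i y n k}" (is "infinite ?A")
proof
  assume fin: "finite ?A"
  define N where "N = Max (insert 0 ((\<lambda>q. nat (Max (range (\<lambda>j. \<bar>fst q $ j - w $ j\<bar>)))) ` ?A))"
  have N: "fst q \<in> cube w N" if "q \<in> ?A" for q
  proof -
    have "nat (Max (range (\<lambda>j. \<bar>fst q $ j - w $ j\<bar>))) \<le> N"
      unfolding N_def using fin that by (intro Max_ge) auto
    moreover have "\<bar>fst q $ j - w $ j\<bar> \<le> Max (range (\<lambda>j. \<bar>fst q $ j - w $ j\<bar>))" for j
      by (intro Max_ge) auto
    ultimately show ?thesis unfolding cube_def by (force simp: nat_le_iff intro: order_trans)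
  qed
  \<comment> \<open>The factor 2 gives \<open>N \<le> \<rho> div 2\<close>, since
    \<open>spread\<close> places \<open>y\<close> only outside the cube of half the radius.\<close>
  define \<rho> where "\<rho> = max R0 (2 * N)"
  define x where "x = (\<chi> j. w $ j + int (Suc \<rho>))"
  have "x \<in> cube w (Suc \<rho>)" "x \<notin> cube w \<rho>" by (auto simp: x_def cube_def)
  from spread[OF _ this] obtain y where
    y: "y \<in> cube w (Suc \<rho>)" "y \<notin> cube w (\<rho> div 2)" "1 \<le> \<eta> y" by (auto simp: \<rho>_def)
  have "R0 \<le> Suc \<rho>" by (simp add: \<rho>_def)
  from cube_awake[OF this y(1) contained] have "awake (T (Suc \<rho>)) y" .
  moreover have "y \<notin> {l, l'}"
    using y(2) loser_cube cube_mono[of "R0 div 2" "\<rho> div 2"] by (auto simp: \<rho>_def div_le_mono)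
  ultimately have "(y, 1) \<in> ?A" using winner_active[OF contained _ y(3)] by blast
  from N[OF this] y(2) cube_mono[of N "\<rho> div 2" w] show False
    unfolding \<rho>_def by force
qed

end

section \<open>Simple random walk\<close>

lemma unit_steps_image: "unit_steps = (\<lambda>(a, s). axis a s) ` (UNIV \<times> {1, -1})"
  by (auto simp: unit_steps_def)

lemma inj_on_unit_steps: "inj_on (\<lambda>(a, s :: int). axis a s) (UNIV \<times> {1, -1})"
  by (auto simp: inj_on_def axis_eq_axis)

lemma finite_unit_steps [simp]: "finite unit_steps"
  by (simp add: unit_steps_image)

lemma sum_unit_steps:
  "(\<Sum>u\<in>unit_steps. f u) = (\<Sum>a\<in>UNIV. f (axis a 1) + f (axis a (- 1)))"
proof -
  have "(\<Sum>u\<in>unit_steps. f u) = (\<Sum>(a, s)\<in>UNIV \<times> {1, -1}. f (axis a s))"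
    unfolding unit_steps_image by (subst sum.reindex[OF inj_on_unit_steps]) (auto intro: sum.cong)
  then show ?thesis by (simp add: sum.cartesian_product[symmetric])
qed

lemma card_unit_steps: "card (unit_steps :: (int ^ 'd::finite) set) = 2 * CARD('d)"
  unfolding unit_steps_image by (subst card_image[OF inj_on_unit_steps]) (simp add: card_cartesian_product)

lemma unit_steps_nonempty [simp]: "unit_steps \<noteq> ({} :: (int ^ 'd::finite) set)"
  using card_unit_steps[where 'd = 'd] by (auto simp del: card_unit_steps)

lemma unit_step_component: "u \<in> unit_steps \<Longrightarrow> \<bar>u $ a\<bar> \<le> 1"
  by (auto simp: unit_steps_def axis_def)

section \<open>Averages over nearest-neighbour paths and their moments\<close>

definition step_lists :: "nat \<Rightarrow> (int ^ 'd::finite) list set" where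
  "step_lists n = {xs. set xs \<subseteq> unit_steps \<and> length xs = n}"

lemma finite_step_lists [simp]: "finite (step_lists n)"
  unfolding step_lists_def by (rule finite_lists_length_eq) simp

lemma card_step_lists: "card (step_lists n :: (int ^ 'd::finite) list set) = (2 * CARD('d)) ^ n"
  unfolding step_lists_def by (simp add: card_lists_length_eq card_unit_steps)

lemma step_lists_0 [simp]: "step_lists 0 = {[]}"
  by (auto simp: step_lists_def)

lemma step_lists_Suc: "step_lists (Suc n) = (\<lambda>(u, xs). u # xs) ` (unit_steps \<times> step_lists n)"
proof -
  have "xs \<in> (\<lambda>(u, xs). u # xs) ` (unit_steps \<times> step_lists n)" if "xs \<in> step_lists (Suc n)" for xs :: "(int ^ 'a) list"
    using that by (cases xs) (auto simp: step_lists_def)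
  then show ?thesis by (auto simp: step_lists_def)
qed

text \<open>The expectation of a function of \<open>n\<close> increments, written as a finite
  average so that moments follow by induction on \<open>n\<close> without measure theory;
  \<open>prob_block\<close> connects it with the model.\<close>

definition walk_mean :: "nat \<Rightarrow> ((int ^ 'd::finite) list \<Rightarrow> real) \<Rightarrow> real" where
  "walk_mean n F = (\<Sum>xs\<in>step_lists n. F xs) / real (2 * CARD('d)) ^ n"

lemma walk_mean_0 [simp]: "walk_mean 0 F = F []"
  by (simp add: walk_mean_def)

lemma walk_mean_Suc:
  fixes F :: "(int ^ 'd::finite) list \<Rightarrow> real"
  shows "walk_mean (Suc n) F
    = (\<Sum>u\<in>unit_steps. walk_mean n (\<lambda>xs. F (u # xs))) / real (2 * CARD('d))"
proof -
  have "(\<Sum>xs\<in>step_lists (Suc n). F xs) = (\<Sum>u\<in>unit_steps. \<Sum>xs\<in>step_lists n. F (u # xs))"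
    unfolding step_lists_Suc sum.cartesian_product
    by (subst sum.reindex) (auto simp: inj_on_def intro: sum.cong)
  then show ?thesis by (simp add: walk_mean_def sum_divide_distrib field_simps)
qed

lemma walk_mean_const [simp]: "walk_mean n (\<lambda>_. a) = a"
  by (simp add: walk_mean_def card_step_lists)

lemma walk_mean_add: "walk_mean n (\<lambda>xs. F xs + G xs) = walk_mean n F + walk_mean n G"
  by (simp add: walk_mean_def sum.distrib add_divide_distrib)

lemma walk_mean_diff: "walk_mean n (\<lambda>xs. F xs - G xs) = walk_mean n F - walk_mean n G"
  by (simp add: walk_mean_def sum_subtractf diff_divide_distrib)

lemma walk_mean_cmult: "walk_mean n (\<lambda>xs. a * F xs) = a * walk_mean n F"
  by (simp add: walk_mean_def sum_distrib_left)

lemma walk_mean_divide: "walk_mean n (\<lambda>xs. F xs / a) = walk_mean n F / a"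
  using walk_mean_cmult[of n "inverse a" F] by (simp add: field_simps)

lemma walk_mean_sum: "walk_mean n (\<lambda>xs. \<Sum>v\<in>A. F v xs) = (\<Sum>v\<in>A. walk_mean n (F v))"
  unfolding walk_mean_def by (subst sum.swap) (simp add: sum_divide_distrib)

lemma walk_mean_mono:
  "(\<And>xs. xs \<in> step_lists n \<Longrightarrow> F xs \<le> G xs) \<Longrightarrow> walk_mean n F \<le> walk_mean n G"
  unfolding walk_mean_def by (intro divide_right_mono sum_mono) auto

text \<open>A single coordinate performs a lazy walk: the first step lies along axis
  \<open>a\<close> with probability \<open>1 / CARD('d)\<close>, in either direction equally likely,
  and otherwise leaves the coordinate unchanged.\<close>

lemma walk_mean_Suc_component:
  fixes a :: "'d::finite"
  shows "walk_mean (Suc n) (\<lambda>xs. F (sum_list xs $ a))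
    = (walk_mean n (\<lambda>xs. F (sum_list xs $ a + 1)) + walk_mean n (\<lambda>xs. F (sum_list xs $ a - 1))
        + 2 * (real CARD('d) - 1) * walk_mean n (\<lambda>xs. F (sum_list xs $ a))) / (2 * real CARD('d))"
proof -
  let ?m = "\<lambda>k. walk_mean n (\<lambda>xs. F (sum_list xs $ a + k))"
  have "walk_mean (Suc n) (\<lambda>xs. F (sum_list xs $ a))
      = (\<Sum>b\<in>UNIV. ?m (axis b 1 $ a) + ?m (axis b (- 1) $ a)) / real (2 * CARD('d))"
    by (simp add: walk_mean_Suc sum_unit_steps add.commute)
  also have "(\<Sum>b\<in>UNIV. ?m (axis b 1 $ a) + ?m (axis b (- 1) $ a))
      = (\<Sum>b\<in>UNIV. (if b = a then ?m 1 + ?m (- 1) - 2 * ?m 0 else 0) + 2 * ?m 0)"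
    by (intro sum.cong) (auto simp: axis_def)
  also have "\<dots> = ?m 1 + ?m (- 1) - 2 * ?m 0 + 2 * real CARD('d) * ?m 0"
    by (simp add: sum.distrib)
  finally show ?thesis by (simp add: algebra_simps)
qed

lemma walk_mean_second_moment:
  fixes a :: "'d::finite"
  shows "walk_mean n (\<lambda>xs. (real_of_int (sum_list xs $ a))\<^sup>2) = real n / real CARD('d)"
proof (induction n)
  case (Suc n)
  let ?m = "walk_mean n (\<lambda>xs. (real_of_int (sum_list xs $ a))\<^sup>2)"
  have "walk_mean n (\<lambda>xs. (real_of_int (sum_list xs $ a + 1))\<^sup>2)
      + walk_mean n (\<lambda>xs. (real_of_int (sum_list xs $ a - 1))\<^sup>2) = 2 * ?m + 2"
    unfolding walk_mean_add[symmetric] walk_mean_cmult[symmetric]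
    by (subst (4) walk_mean_const[of n, symmetric], subst walk_mean_add[symmetric])
       (simp add: power2_eq_square algebra_simps)
  with Suc show ?case
    by (subst walk_mean_Suc_component) (simp add: field_simps)
qed simp

text \<open>In one step the moment grows by six times the second moment over the dimension, plus the
  inverse dimension. This is at most \<open>6 * n + 1\<close>, while the right-hand side grows by
  \<open>6 * n + 3\<close>.\<close>

lemma walk_mean_fourth_moment:
  fixes a :: "'d::finite"
  shows "walk_mean n (\<lambda>xs. (real_of_int (sum_list xs $ a)) ^ 4) \<le> 3 * (real n)\<^sup>2"
proof (induction n)
  case (Suc n)
  let ?d = "real CARD('d)"
  let ?m2 = "walk_mean n (\<lambda>xs. (real_of_int (sum_list xs $ a))\<^sup>2)"
  let ?m4 = "walk_mean n (\<lambda>xs. (real_of_int (sum_list xs $ a)) ^ 4)"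
  have "walk_mean n (\<lambda>xs. (real_of_int (sum_list xs $ a + 1)) ^ 4)
      + walk_mean n (\<lambda>xs. (real_of_int (sum_list xs $ a - 1)) ^ 4)
      = walk_mean n (\<lambda>xs. 2 * (real_of_int (sum_list xs $ a)) ^ 4
          + (12 * (real_of_int (sum_list xs $ a))\<^sup>2 + 2))"
    unfolding walk_mean_add[symmetric] by (simp add: power4_eq_xxxx power2_eq_square algebra_simps)
  also have "\<dots> = 2 * ?m4 + (12 * ?m2 + 2)"
    by (simp add: walk_mean_add walk_mean_cmult)
  finally have "walk_mean (Suc n) (\<lambda>xs. (real_of_int (sum_list xs $ a)) ^ 4)
      = ?m4 + 6 * (?m2 / ?d) + 1 / ?d"
    by (subst walk_mean_Suc_component[where F = "\<lambda>k. real_of_int k ^ 4"]) (simp add: field_simps)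
  also have "?m2 / ?d \<le> real n"
  proof -
    have "1 \<le> ?d" by (simp add: Suc_le_eq)
    then have "1 * 1 \<le> ?d * ?d" by (intro mult_mono) auto
    then have "real n * 1 \<le> real n * (?d * ?d)" by (intro mult_left_mono) auto
    then show ?thesis unfolding walk_mean_second_moment by (simp add: field_simps)
  qed
  also have "1 / ?d \<le> 1" by (simp add: Suc_le_eq)
  finally show ?case using Suc by (simp add: power2_eq_square algebra_simps)
qed simp

text \<open>Compare moments through \<open>\<bar>x\<bar> \<ge> x\<^sup>2 / b - x ^ 4 / b ^ 3\<close> with \<open>b\<^sup>2 = 6 d n\<close>.\<close>
lemma walk_mean_abs_ge:
  fixes a :: "'d::finite"
  shows "sqrt (real n) / (2 * real CARD('d) * sqrt (6 * real CARD('d)))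
    \<le> walk_mean n (\<lambda>xs. \<bar>real_of_int (sum_list xs $ a)\<bar>)"
proof (cases "n = 0")
  case False
  let ?d = "real CARD('d)"
  define b where "b = sqrt (6 * ?d) * sqrt (real n)"
  have d: "?d > 0" and b: "b > 0" using False by (auto simp: b_def)
  have b2: "b * b = 6 * ?d * real n" by (simp add: b_def flip: real_sqrt_mult)
  have *: "x\<^sup>2 / b - x ^ 4 / (b * b * b) \<le> \<bar>x\<bar>" for x
  proof -
    \<comment> \<open>After rescaling, the claim is that the square of \<open>u\<close> minus its
      fourth power is at most \<open>u\<close>; the square is at most \<open>u\<close> for
      \<open>u \<le> 1\<close>, and the left-hand side is nonpositive for
      \<open>u > 1\<close>.\<close>
    define u where "u = \<bar>x\<bar> / b"
    have "u \<ge> 0" using b by (simp add: u_def)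
    have "u * u - u * u * u * u \<le> u"
    proof (cases "u \<le> 1")
      case True
      with \<open>u \<ge> 0\<close> have "u * u \<le> u" by (simp add: mult_left_le)
      moreover have "0 \<le> u * u * u * u" using \<open>u \<ge> 0\<close> by simp
      ultimately show ?thesis by linarith
    next
      case False
      then have "1 \<le> u * u" using \<open>u \<ge> 0\<close> by (metis less_eq_real_def mult_mono' mult_1 not_le zero_le_one)
      then have "(u * u) * 1 \<le> (u * u) * (u * u)" by (intro mult_left_mono) auto
      with \<open>u \<ge> 0\<close> show ?thesis by (simp add: mult.assoc)
    qed
    then have "b * (u * u - u * u * u * u) \<le> b * u" using b by (intro mult_left_mono) auto
    moreover have "\<bar>x\<bar> = b * u" using b by (simp add: u_def)
    moreover have "x\<^sup>2 = (b * u)\<^sup>2" "x ^ 4 = (b * u) ^ 4"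
      by (metis \<open>\<bar>x\<bar> = b * u\<close> power2_abs, metis \<open>\<bar>x\<bar> = b * u\<close> power_even_abs even_numeral)
    ultimately show ?thesis using b by (simp add: power4_eq_xxxx power2_eq_square field_simps)
  qed
  \<comment> \<open>The value of \<open>b\<close> makes the fourth-moment term exactly half of the
    second-moment term, which explains the factor 2 in the constant.\<close>
  have "sqrt (real n) / (2 * ?d * sqrt (6 * ?d)) = real n / ?d / b - 3 * (real n)\<^sup>2 / (b * b * b)"
  proof -
    have "3 * (real n)\<^sup>2 / (b * b * b) = real n / (2 * ?d * b)"
      unfolding b2 using False d b by (simp add: field_simps power2_eq_square)
    moreover have "sqrt (real n) / (2 * ?d * sqrt (6 * ?d)) = real n / (2 * ?d * b)"
    proof -
      have "real n = sqrt (real n) * sqrt (real n)" by simp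
      then have "real n / (2 * ?d * b) = sqrt (real n) * sqrt (real n) / (2 * ?d * (sqrt (6 * ?d) * sqrt (real n)))"
        unfolding b_def by (rule arg_cong)
      also have "\<dots> = sqrt (real n) / (2 * ?d * sqrt (6 * ?d))" using False d by (simp add: field_simps)
      finally show ?thesis ..
    qed
    ultimately show ?thesis using d b by (simp add: field_simps)
  qed
  also have "\<dots> \<le> walk_mean n (\<lambda>xs. (real_of_int (sum_list xs $ a))\<^sup>2) / b
      - walk_mean n (\<lambda>xs. (real_of_int (sum_list xs $ a)) ^ 4) / (b * b * b)"
    unfolding walk_mean_second_moment
    using walk_mean_fourth_moment[of n a] b by (intro diff_mono divide_right_mono) auto
  also have "\<dots> \<le> walk_mean n (\<lambda>xs. \<bar>real_of_int (sum_list xs $ a)\<bar>)"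
    unfolding walk_mean_divide[symmetric] walk_mean_diff[symmetric] by (intro walk_mean_mono *)
  finally show ?thesis .
qed simp

section \<open>Exponential moments and large deviations\<close>

lemma exp_le_quadratic: "exp x \<le> 1 + x + x\<^sup>2" if "\<bar>x\<bar> \<le> 1" for x :: real
proof (cases "x \<ge> 0")
  case True
  with that show ?thesis by (intro exp_bound) auto
next
  case False
  define y where "y = - x"
  have y: "0 < y" "y \<le> 1" using False that by (auto simp: y_def)
  have "exp x = 1 / exp y" by (simp add: y_def exp_minus field_simps)
  also have "\<dots> \<le> 1 / (1 + y)" using y by (intro divide_left_mono) auto
  also have "\<dots> \<le> 1 - y + y\<^sup>2"
    using y by (simp add: field_simps power2_eq_square)
  finally show ?thesis by (simp add: y_def)
qed

text \<open>Each step multiplies the exponential moment by a weighted average of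
  \<open>cosh r\<close> and 1. For \<open>\<bar>r\<bar> \<le> 1\<close> this is at most
  \<open>1 + r\<^sup>2\<close>, hence at most \<open>exp (r\<^sup>2)\<close>.\<close>

lemma walk_mean_exp_le:
  fixes a :: "'d::finite"
  assumes "\<bar>r\<bar> \<le> 1"
  shows "walk_mean n (\<lambda>xs. exp (r * real_of_int (sum_list xs $ a))) \<le> exp (r\<^sup>2 * real n)"
proof (induction n)
  case (Suc n)
  let ?d = "real CARD('d)" and ?m = "walk_mean n (\<lambda>xs. exp (r * real_of_int (sum_list xs $ a)))"
  have d: "1 \<le> ?d" by (simp add: Suc_le_eq)
  have m: "0 \<le> ?m" by (auto simp: walk_mean_def intro!: divide_nonneg_nonneg sum_nonneg)
  have shift: "walk_mean n (\<lambda>xs. exp (r * real_of_int (sum_list xs $ a + k)))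
      = exp (r * real_of_int k) * ?m" for k
    unfolding walk_mean_cmult[symmetric] by (simp add: exp_add[symmetric] algebra_simps)
  have "walk_mean (Suc n) (\<lambda>xs. exp (r * real_of_int (sum_list xs $ a)))
      = ((exp r + exp (- r) + 2 * (?d - 1)) / (2 * ?d)) * ?m"
    using shift[of 1] shift[of "- 1"]
    by (subst walk_mean_Suc_component[where F = "\<lambda>k. exp (r * real_of_int k)"])
       (simp add: distrib_right)
  also have "(exp r + exp (- r) + 2 * (?d - 1)) / (2 * ?d) \<le> 1 + r\<^sup>2"
  proof -
    have "exp r + exp (- r) \<le> 2 + 2 * r\<^sup>2"
      using exp_le_quadratic[of r] exp_le_quadratic[of "- r"] assms by simp
    moreover have "r\<^sup>2 * 1 \<le> r\<^sup>2 * ?d" using d by (intro mult_left_mono) auto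
    ultimately show ?thesis using d by (simp add: field_simps)
  qed
  also have "1 + r\<^sup>2 \<le> exp (r\<^sup>2)" by (rule exp_ge_add_one_self)
  finally have "walk_mean (Suc n) (\<lambda>xs. exp (r * real_of_int (sum_list xs $ a))) \<le> exp (r\<^sup>2) * ?m"
    using m by (simp add: mult_right_mono)
  also have "\<dots> \<le> exp (r\<^sup>2) * exp (r\<^sup>2 * real n)" using Suc by simp
  finally show ?case by (simp add: exp_add[symmetric] algebra_simps)
qed simp

text \<open>Markov's inequality for \<open>exp (r * X) + exp (- r * X)\<close>, which dominates
  \<open>exp (r * \<bar>X\<bar>)\<close>. The parameter \<open>r\<close> stays free and is later
  tuned to the radius.\<close>

lemma walk_mean_deviation:
  fixes a :: "'d::finite"
  assumes "0 \<le> r" "r \<le> 1"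
  shows "walk_mean n (\<lambda>xs. of_bool (b \<le> \<bar>real_of_int (sum_list xs $ a)\<bar>))
    \<le> 2 * exp (r\<^sup>2 * real n - r * b)"
proof -
  have "walk_mean n (\<lambda>xs. of_bool (b \<le> \<bar>real_of_int (sum_list xs $ a)\<bar>))
      \<le> walk_mean n (\<lambda>xs. exp (- (r * b)) * (exp (r * real_of_int (sum_list xs $ a))
          + exp (- r * real_of_int (sum_list xs $ a))))"
  proof (rule walk_mean_mono)
    fix xs :: "(int ^ 'd) list"
    let ?c = "real_of_int (sum_list xs $ a)"
    have "1 \<le> exp (- (r * b)) * (exp (r * ?c) + exp (- r * ?c))" if "b \<le> \<bar>?c\<bar>"
    proof -
      have "r * b \<le> r * \<bar>?c\<bar>" using that assms by (intro mult_left_mono) auto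
      then have "exp (r * b) \<le> exp (r * \<bar>?c\<bar>)" by simp
      also have "\<dots> \<le> exp (r * ?c) + exp (- r * ?c)" by (cases "?c \<ge> 0") (auto simp: abs_if)
      finally show ?thesis by (simp add: exp_minus field_simps)
    qed
    moreover have "0 \<le> exp (- (r * b)) * (exp (r * ?c) + exp (- r * ?c))"
      by (intro mult_nonneg_nonneg add_nonneg_nonneg) auto
    ultimately show "of_bool (b \<le> \<bar>?c\<bar>) \<le> exp (- (r * b)) * (exp (r * ?c) + exp (- r * ?c))"
      by simp
  qed
  also have "\<dots> \<le> exp (- (r * b)) * (exp (r\<^sup>2 * real n) + exp (r\<^sup>2 * real n))"
    unfolding walk_mean_cmult walk_mean_add
    using walk_mean_exp_le[of r n a] walk_mean_exp_le[of "- r" n a] assms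
    by (intro mult_left_mono add_mono) auto
  also have "\<dots> = 2 * exp (r\<^sup>2 * real n - r * b)"
    by (simp add: exp_diff exp_minus field_simps)
  finally show ?thesis .
qed

section \<open>Visited sites, reflections and orthants\<close>

definition visited :: "(int ^ 'd::finite) list \<Rightarrow> (int ^ 'd) set" where
  "visited xs = (\<lambda>m. sum_list (take m xs)) ` {..length xs}"

text \<open>Closed orthants overlap on their faces, which is harmless since they are only summed
  over to cover all visited sites off the hyperplane. The condition on \<open>a\<close> ensures that
  a displacement in the orthant really changes this coordinate.\<close>

definition orthant :: "('d::finite \<Rightarrow> bool) \<Rightarrow> 'd \<Rightarrow> (int ^ 'd) set" where
  "orthant s a = {v. v $ a \<noteq> 0 \<and> (\<forall>j. if s j then v $ j \<ge> 0 else v $ j \<le> 0)}"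

definition flip :: "('d::finite \<Rightarrow> bool) \<Rightarrow> int ^ 'd \<Rightarrow> int ^ 'd" where
  "flip s v = (\<chi> j. if s j then v $ j else - v $ j)"

lemma finite_visited [simp]: "finite (visited xs)"
  by (simp add: visited_def)

lemma flip_flip [simp]: "flip s (flip s v) = v"
  by (simp add: flip_def vec_eq_iff)

lemma flip_add: "flip s (u + v) = flip s u + flip s v"
  by (simp add: flip_def vec_eq_iff)

lemma flip_0 [simp]: "flip s 0 = 0"
  by (simp add: flip_def vec_eq_iff)

lemma flip_sum_list: "flip s (sum_list xs) = sum_list (map (flip s) xs)"
  by (induction xs) (auto simp: flip_add)

lemma visited_flip: "visited (map (flip s) xs) = flip s ` visited xs"
  unfolding visited_def image_image by (simp add: flip_sum_list take_map)

lemma flip_unit_steps: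
  assumes "u \<in> unit_steps"
  shows "flip s u \<in> unit_steps"
proof -
  from assms obtain a e where "u = axis a e" "e \<in> {1, - 1}" by (auto simp: unit_steps_def)
  then have "flip s u = axis a (if s a then e else - e)"
    by (auto simp: flip_def axis_def vec_eq_iff)
  with \<open>e \<in> {1, - 1}\<close> show ?thesis by (auto simp: unit_steps_def)
qed

lemma walk_mean_flip: "walk_mean n (\<lambda>xs. F (map (flip s) xs)) = walk_mean n F"
proof -
  have "map (flip s) ` step_lists n \<subseteq> step_lists n"
    by (auto simp: step_lists_def subset_iff intro!: flip_unit_steps)
  then have "bij_betw (map (flip s)) (step_lists n) (step_lists n)"
    by (intro bij_betwI[where g = "map (flip s)"]) (auto simp: o_def map_idI)
  from sum.reindex_bij_betw[OF this, of F] show ?thesis by (simp add: walk_mean_def)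
qed

lemma orthant_flip: "flip s v \<in> orthant s a \<longleftrightarrow> v \<in> orthant (\<lambda>_. True) a"
  by (auto simp: orthant_def flip_def split: if_splits)

lemma walk_mean_visited_orthant:
  "walk_mean n (\<lambda>xs. real (card (visited xs \<inter> orthant s a)))
    = walk_mean n (\<lambda>xs. real (card (visited xs \<inter> orthant (\<lambda>_. True) a)))"
proof -
  have "card (visited (map (flip s) xs) \<inter> orthant s a) = card (visited xs \<inter> orthant (\<lambda>_. True) a)"
    for xs :: "(int ^ 'a) list"
  proof -
    have "visited (map (flip s) xs) \<inter> orthant s a = flip s ` (visited xs \<inter> orthant (\<lambda>_. True) a)"
      unfolding visited_flip using orthant_flip[of s _ a] by blast
    moreover have "inj (flip s)" by (rule inj_on_inverseI[where g = "flip s"]) simp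
    ultimately show ?thesis by (simp add: card_image inj_on_subset)
  qed
  then show ?thesis
    by (subst walk_mean_flip[of n _ s, symmetric]) simp
qed

text \<open>The modulus of the \<open>a\<close>-coordinate starts at 0 and changes by at most one
  per step, so by the discrete intermediate value theorem it attains every value from 1 to its final
  value, each at a different site.\<close>

lemma card_visited_ge:
  assumes "set xs \<subseteq> unit_steps"
  shows "\<bar>sum_list xs $ a\<bar> \<le> int (card (visited xs \<inter> {v. v $ a \<noteq> 0}))"
proof -
  define f where "f m = \<bar>sum_list (take m xs) $ a\<bar>" for m
  have "\<bar>f (m + 1) - f m\<bar> \<le> 1" if "m < length xs" for m
  proof -
    have "xs ! m \<in> unit_steps" using assms that by auto
    from unit_step_component[OF this, of a] show ?thesis
      using that by (simp add: f_def take_Suc_conv_app_nth)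
  qed
  moreover have "f 0 = 0" by (simp add: f_def)
  ultimately have "\<exists>m\<le>length xs. f m = k" if "0 \<le> k" "k \<le> f (length xs)" for k
    using nat_intermed_int_val[of 0 "length xs" f k] that by auto
  note ivt = this
  have "{1..f (length xs)} \<subseteq> (\<lambda>v. \<bar>v $ a\<bar>) ` (visited xs \<inter> {v. v $ a \<noteq> 0})"
  proof
    fix k assume k: "k \<in> {1..f (length xs)}"
    with ivt[of k] obtain m where m: "m \<le> length xs" "f m = k" by auto
    then have "sum_list (take m xs) \<in> visited xs \<inter> {v. v $ a \<noteq> 0}"
      using k by (auto simp: visited_def f_def)
    moreover have "k = \<bar>sum_list (take m xs) $ a\<bar>" using m by (simp add: f_def)
    ultimately show "k \<in> (\<lambda>v. \<bar>v $ a\<bar>) ` (visited xs \<inter> {v. v $ a \<noteq> 0})" by (rule rev_image_eqI)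
  qed
  then have "card {1..f (length xs)} \<le> card (visited xs \<inter> {v. v $ a \<noteq> 0})"
    by (meson card_image_le card_mono finite_Int finite_imageI finite_visited le_trans)
  then show ?thesis by (simp add: f_def)
qed

lemma visited_cube:
  assumes "set xs \<subseteq> unit_steps" "v \<in> visited xs"
  shows "\<bar>v $ j\<bar> \<le> int (length xs)"
proof -
  have "\<bar>sum_list ys $ j\<bar> \<le> int (length ys)" if "set ys \<subseteq> unit_steps" for ys :: "(int ^ 'a) list"
    using that
  proof (induction ys)
    case (Cons u ys)
    then show ?case using unit_step_component[of u j] by auto
  qed simp
  note bound = this
  obtain m where m: "m \<le> length xs" "v = sum_list (take m xs)"
    using assms(2) by (auto simp: visited_def)
  have "set (take m xs) \<subseteq> unit_steps" using assms(1) set_take_subset[of m xs] by (rule order_trans[rotated])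
  from bound[OF this] m show ?thesis by simp
qed

text \<open>The sum is the expected number of sites visited in an orthant. By reflection symmetry all
  orthants contribute equally, and the walk visits at least as many sites off the hyperplane
  \<open>v $ a = 0\<close> as the modulus of its final \<open>a\<close>-coordinate.\<close>
lemma sum_hitting_probabilities_ge:
  fixes a :: "'d::finite"
  shows "sqrt (real n) / (2 * real CARD('d) * sqrt (6 * real CARD('d)) * 2 ^ CARD('d))
    \<le> (\<Sum>v\<in>orthant s a \<inter> {v. \<forall>j. \<bar>v $ j\<bar> \<le> int n}. walk_mean n (\<lambda>xs. of_bool (v \<in> visited xs)))"
proof -
  let ?N = "2 ^ CARD('d) :: real"
  let ?m = "walk_mean n (\<lambda>xs. real (card (visited xs \<inter> orthant s a)))"
  let ?B = "{v :: int ^ 'd. \<forall>j. \<bar>v $ j\<bar> \<le> int n}"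
  have "finite ?B"
  proof (rule finite_subset)
    show "?B \<subseteq> vec_lambda ` (\<Pi>\<^sub>E j\<in>UNIV. {- int n..int n})"
    proof
      fix v assume "v \<in> ?B"
      then have *: "\<bar>v $ j\<bar> \<le> int n" for j by blast
      have "v $ j \<in> {- int n..int n}" for j using *[of j] by (simp add: abs_le_iff)
      then have "vec_nth v \<in> (\<Pi>\<^sub>E j\<in>UNIV. {- int n..int n})" by blast
      moreover have "v = vec_lambda (vec_nth v)" by simp
      ultimately show "v \<in> vec_lambda ` (\<Pi>\<^sub>E j\<in>UNIV. {- int n..int n})" by blast
    qed
    show "finite (vec_lambda ` (\<Pi>\<^sub>E j\<in>(UNIV :: 'd set). {- int n..int n}))"
      by (intro finite_imageI finite_PiE) auto
  qed
  have "walk_mean n (\<lambda>xs. \<bar>real_of_int (sum_list xs $ a)\<bar>)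
      \<le> walk_mean n (\<lambda>xs. \<Sum>s\<in>UNIV. real (card (visited xs \<inter> orthant s a)))"
  proof (rule walk_mean_mono)
    fix xs :: "(int ^ 'd) list" assume "xs \<in> step_lists n"
    then have "\<bar>sum_list xs $ a\<bar> \<le> int (card (visited xs \<inter> {v. v $ a \<noteq> 0}))"
      by (intro card_visited_ge) (simp add: step_lists_def)
    also have "visited xs \<inter> {v. v $ a \<noteq> 0} \<subseteq> (\<Union>s\<in>UNIV. visited xs \<inter> orthant s a)"
    proof
      fix v assume "v \<in> visited xs \<inter> {v. v $ a \<noteq> 0}"
      then have "v \<in> visited xs \<inter> orthant (\<lambda>j. v $ j \<ge> 0) a" by (auto simp: orthant_def)
      then show "v \<in> (\<Union>s\<in>UNIV. visited xs \<inter> orthant s a)" by blast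
    qed
    then have "card (visited xs \<inter> {v. v $ a \<noteq> 0}) \<le> card (\<Union>s\<in>UNIV. visited xs \<inter> orthant s a)"
      by (intro card_mono) auto
    also have "\<dots> \<le> (\<Sum>s\<in>UNIV. card (visited xs \<inter> orthant s a))"
      by (intro card_UN_le) auto
    finally have "\<bar>sum_list xs $ a\<bar> \<le> int (\<Sum>s\<in>UNIV. card (visited xs \<inter> orthant s a))"
      by simp
    then have "real_of_int \<bar>sum_list xs $ a\<bar>
        \<le> real_of_int (int (\<Sum>s\<in>UNIV. card (visited xs \<inter> orthant s a)))"
      unfolding of_int_le_iff .
    then show "\<bar>real_of_int (sum_list xs $ a)\<bar> \<le> (\<Sum>s\<in>UNIV. real (card (visited xs \<inter> orthant s a)))"
      by simp
  qed
  also have "\<dots> = (\<Sum>s'\<in>(UNIV :: ('d \<Rightarrow> bool) set). ?m)"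
    unfolding walk_mean_sum
    by (intro sum.cong refl) (metis walk_mean_visited_orthant)
  also have "\<dots> = ?N * ?m"
    by (simp add: card_fun)
  finally have "sqrt (real n) / (2 * real CARD('d) * sqrt (6 * real CARD('d))) \<le> ?N * ?m"
    using walk_mean_abs_ge[of n a] by linarith
  then have "sqrt (real n) / (2 * real CARD('d) * sqrt (6 * real CARD('d)) * ?N) \<le> ?m"
    by (simp add: field_simps)
  also have "?m \<le> walk_mean n (\<lambda>xs. \<Sum>v\<in>orthant s a \<inter> ?B. of_bool (v \<in> visited xs))"
  proof (rule walk_mean_mono)
    fix xs :: "(int ^ 'd) list" assume "xs \<in> step_lists n"
    then have "visited xs \<subseteq> ?B" using visited_cube[of xs] by (auto simp: step_lists_def)
    then have "visited xs \<inter> orthant s a = {v \<in> orthant s a \<inter> ?B. v \<in> visited xs}" by auto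
    with \<open>finite ?B\<close> show "real (card (visited xs \<inter> orthant s a))
        \<le> (\<Sum>v\<in>orthant s a \<inter> ?B. of_bool (v \<in> visited xs))"
      by (simp add: sum_of_bool_eq Int_def)
  qed
  finally show ?thesis by (simp add: walk_mean_sum)
qed

section \<open>Walks through a prescribed finite set\<close>

lemma ex_unit_walk: "\<exists>xs. set xs \<subseteq> unit_steps \<and> sum_list xs = (v :: int ^ 'd::finite)"
proof -
  let ?P = "\<lambda>v :: int ^ 'd. \<exists>xs. set xs \<subseteq> unit_steps \<and> sum_list xs = v"
  have add: "?P (u + v)" if "?P u" "?P v" for u v
    using that by (metis sum_list_append set_append Un_least)
  have ax: "?P (axis a k)" for a k
  proof (induction k rule: int_induct[where k = 0])
    case base
    show ?case by (intro exI[of _ "[]"]) (auto simp: axis_def vec_eq_iff)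
  next
    case (step1 k)
    have "?P (axis a 1)" by (intro exI[of _ "[axis a 1]"]) (auto simp: unit_steps_def)
    from add[OF step1(2) this] show ?case by (simp add: axis_def vec_eq_iff if_distrib cong: if_cong)
  next
    case (step2 k)
    have "?P (axis a (- 1))" by (intro exI[of _ "[axis a (- 1)]"]) (auto simp: unit_steps_def)
    from add[OF step2(2) this] show ?case by (simp add: axis_def vec_eq_iff if_distrib cong: if_cong)
  qed
  have "?P (\<Sum>a\<in>A. axis a (v $ a))" if "finite A" for A
    using that by induction (auto intro: add ax exI[of _ "[]"])
  from this[of UNIV] have "?P (\<Sum>a\<in>UNIV. axis a (v $ a))" by simp
  also have "(\<Sum>a\<in>UNIV. axis a (v $ a)) = v"
    by (simp add: vec_eq_iff axis_def if_distrib cong: if_cong)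
  finally show ?thesis .
qed

lemma ex_covering_walk:
  assumes "finite A"
  shows "\<exists>xs. set xs \<subseteq> unit_steps \<and> A \<subseteq> visited xs"
  using assms
proof induction
  case (insert v A)
  then obtain xs where xs: "set xs \<subseteq> unit_steps" "A \<subseteq> visited xs" by blast
  obtain ys where ys: "set ys \<subseteq> unit_steps" "sum_list ys = v - sum_list xs"
    using ex_unit_walk by blast
  have "visited xs \<subseteq> visited (xs @ ys)"
  proof
    fix u assume "u \<in> visited xs"
    then obtain m where "m \<le> length xs" "u = sum_list (take m xs)" by (auto simp: visited_def)
    then show "u \<in> visited (xs @ ys)" unfolding visited_def by (intro image_eqI[of _ _ m]) auto
  qed
  moreover have "v \<in> visited (xs @ ys)"
    unfolding visited_def by (rule image_eqI[of _ _ "length (xs @ ys)"]) (auto simp: ys)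
  ultimately show ?case using xs ys by (intro exI[of _ "xs @ ys"]) auto
qed (auto intro: exI[of _ "[]"])

section \<open>Measurability\<close>

instance frog_type :: countable by countable_datatype

text \<open>With countably many statuses, measurability of the dynamics can be checked for each
  fixed status separately.\<close>

instance status :: (finite) countable
proof
  let ?f = "\<lambda>s :: 'a status. case s of Absent \<Rightarrow> None | Sleeping \<Rightarrow> Some None
    | Active i y n k \<Rightarrow> Some (Some (i, y, n, k))"
  have "inj ?f" by (auto simp: inj_def split: status.splits)
  then have "inj (to_nat \<circ> ?f)" by (intro inj_compose) auto
  then show "\<exists>f :: 'a status \<Rightarrow> nat. inj f" by blast
qed

lemma measurable_count_space_binary:
  fixes f :: "'a \<Rightarrow> 'b :: countable" and g :: "'a \<Rightarrow> 'c"
  assumes "f \<in> M \<rightarrow>\<^sub>M count_space UNIV" "g \<in> M \<rightarrow>\<^sub>M count_space UNIV"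
  shows "(\<lambda>x. F (f x) (g x)) \<in> M \<rightarrow>\<^sub>M count_space UNIV"
proof (rule measurable_compose_countable[OF _ assms(1)])
  show "(\<lambda>x. F i (g x)) \<in> M \<rightarrow>\<^sub>M count_space UNIV" for i
    by (rule measurable_compose[OF assms(2)]) simp
qed

lemma space_frog_space: "space (frog_space \<nu> N) = UNIV \<times> UNIV \<times> UNIV \<times> space N"
  by (auto simp: frog_space_def space_pair_measure space_PiM)

lemma prob_space_frog_space:
  assumes "prob_space N"
  shows "prob_space (frog_space \<nu> N)"
  unfolding frog_space_def using assms
  by (intro prob_space_pair prob_space_PiM prob_space_measure_pmf prob_space_uniform_measure) auto

lemma measurable_initial_number:
  "(\<lambda>\<omega>. fst \<omega> x) \<in> frog_space \<nu> N \<rightarrow>\<^sub>M count_space UNIV"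
proof -
  have "(\<lambda>\<omega>. fst \<omega> x) \<in> frog_space \<nu> N \<rightarrow>\<^sub>M measure_pmf \<nu>"
    unfolding frog_space_def by measurable
  then show ?thesis by (simp cong: measurable_cong_sets)
qed

lemma measurable_increment:
  "(\<lambda>\<omega>. fst (snd \<omega>) qn) \<in> frog_space \<nu> (N :: 'u measure) \<rightarrow>\<^sub>M count_space (UNIV :: (int ^ 'd::finite) set)"
proof -
  have "(\<lambda>\<omega>. fst (snd \<omega>) qn) \<in> frog_space \<nu> N \<rightarrow>\<^sub>M measure_pmf (pmf_of_set (unit_steps :: (int ^ 'd) set))"
    unfolding frog_space_def by measurable
  then show ?thesis by (simp cong: measurable_cong_sets)
qed

lemma measurable_waiting_variable:
  "(\<lambda>\<omega>. fst (snd (snd \<omega>)) qnk) \<in> borel_measurable (frog_space \<nu> N)"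
proof -
  have "(\<lambda>\<omega>. fst (snd (snd \<omega>)) qnk) \<in> frog_space \<nu> N \<rightarrow>\<^sub>M uniform_measure lborel {0..1}"
    unfolding frog_space_def by measurable
  then show ?thesis by (simp cong: measurable_cong_sets)
qed

lemma measurable_extra_randomness: "(\<lambda>\<omega>. snd (snd (snd \<omega>))) \<in> frog_space \<nu> N \<rightarrow>\<^sub>M N"
  unfolding frog_space_def by measurable

lemma measurable_walk_path:
  "(\<lambda>\<omega>. walk_path (fst (snd \<omega>)) q n) \<in> frog_space \<nu> N \<rightarrow>\<^sub>M count_space UNIV"
proof (induction n)
  case (Suc n)
  have "(\<lambda>\<omega>. walk_path (fst (snd \<omega>)) q n + fst (snd \<omega>) (q, n)) \<in> frog_space \<nu> N \<rightarrow>\<^sub>M count_space UNIV"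
    by (rule measurable_count_space_binary[OF Suc measurable_increment])
  then show ?case by (simp add: walk_path_def add.assoc)
qed (simp add: walk_path_def)

lemma measurable_config_spaceI:
  assumes "\<And>q. (\<lambda>\<omega>. f \<omega> q) \<in> M \<rightarrow>\<^sub>M count_space UNIV"
  shows "f \<in> M \<rightarrow>\<^sub>M config_space"
  unfolding config_space_def by (rule measurable_PiM_single') (use assms in auto)

lemma measurable_config_spaceD:
  "f \<in> M \<rightarrow>\<^sub>M config_space \<Longrightarrow> (\<lambda>\<omega>. f \<omega> q) \<in> M \<rightarrow>\<^sub>M count_space UNIV"
  unfolding config_space_def
  by (rule measurable_compose[OF _ measurable_component_singleton]) auto

lemma measurable_initial_config:
  "(\<lambda>\<omega>. initial_config (fst \<omega>) z) \<in> frog_space \<nu> N \<rightarrow>\<^sub>M config_space"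
proof (rule measurable_config_spaceI)
  fix q :: "'a particle"
  obtain x j where q: "q = (x, j)" by (cases q)
  have "(\<lambda>\<omega>. (\<lambda>n. if 1 \<le> j \<and> j \<le> n then
       (if x = 0 then Active Type1 x 0 0 else if x = z then Active Type2 x 0 0 else Sleeping)
     else Absent) (fst \<omega> x)) \<in> frog_space \<nu> N \<rightarrow>\<^sub>M count_space UNIV"
    by (rule measurable_compose[OF measurable_initial_number]) simp
  then show "(\<lambda>\<omega>. initial_config (fst \<omega>) z q) \<in> frog_space \<nu> N \<rightarrow>\<^sub>M count_space UNIV"
    unfolding initial_config_def q prod.case .
qed

lemma measurable_move_config:
  assumes "f \<in> frog_space \<nu> N \<rightarrow>\<^sub>M config_space"
  shows "(\<lambda>\<omega>. move_config p (fst (snd \<omega>)) (fst (snd (snd \<omega>))) (f \<omega>)) \<in> frog_space \<nu> N \<rightarrow>\<^sub>M config_space"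
proof (rule measurable_config_spaceI)
  fix q
  \<comment> \<open>Freezing the current status \<open>s\<close> leaves a function of the walks and
    waiting variables alone; the random status is substituted afterwards.\<close>
  define g where "g s \<omega> = (case s of
       Active i y n k \<Rightarrow>
         (if fst (snd (snd \<omega>)) (q, n, Suc k) \<le> p i
          then Active i (walk_path (fst (snd \<omega>)) q (Suc n)) (Suc n) 0
          else Active i y n (Suc k))
     | s \<Rightarrow> s)" for s and \<omega> :: "('a, 'b) sample"
  have "g s \<in> frog_space \<nu> N \<rightarrow>\<^sub>M count_space UNIV" for s
  proof (cases s)
    case (Active i y n k)
    have "(\<lambda>\<omega>. if fst (snd (snd \<omega>)) (q, n, Suc k) \<le> p i
          then Active i (walk_path (fst (snd \<omega>)) q (Suc n)) (Suc n) 0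
          else Active i y n (Suc k)) \<in> frog_space \<nu> N \<rightarrow>\<^sub>M count_space UNIV"
    proof (rule measurable_If)
      show "(\<lambda>\<omega>. Active i (walk_path (fst (snd \<omega>)) q (Suc n)) (Suc n) 0) \<in> frog_space \<nu> N \<rightarrow>\<^sub>M count_space UNIV"
        by (rule measurable_compose[OF measurable_walk_path]) simp
      show "{\<omega> \<in> space (frog_space \<nu> N). fst (snd (snd \<omega>)) (q, n, Suc k) \<le> p i} \<in> sets (frog_space \<nu> N)"
        using measurable_waiting_variable by measurable
    qed simp
    then show ?thesis by (simp add: g_def[abs_def] Active)
  qed (simp_all add: g_def[abs_def])
  from measurable_compose_countable[OF this measurable_config_spaceD[OF assms, of q]]
  show "(\<lambda>\<omega>. move_config p (fst (snd \<omega>)) (fst (snd (snd \<omega>))) (f \<omega>) q) \<in> frog_space \<nu> N \<rightarrow>\<^sub>M count_space UNIV"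
    unfolding g_def move_config_def .
qed

lemma measurable_occupied_by:
  assumes "c \<in> M \<rightarrow>\<^sub>M config_space"
  shows "(\<lambda>\<omega>. occupied_by i (x :: 'd::finite site) (c \<omega>)) \<in> M \<rightarrow>\<^sub>M count_space UNIV"
proof -
  have "(\<lambda>\<omega>. c \<omega> q = s) \<in> M \<rightarrow>\<^sub>M count_space UNIV" for q s
    by (rule measurable_compose[OF measurable_config_spaceD[OF assms]]) simp
  then show ?thesis unfolding occupied_by_def by measurable
qed

lemma measurable_activate_config:
  fixes c :: "'a \<Rightarrow> 'd::finite config"
  assumes c: "c \<in> M \<rightarrow>\<^sub>M config_space"
    and \<tau>: "\<And>x j. (\<lambda>\<omega>. \<tau> \<omega> x j) \<in> M \<rightarrow>\<^sub>M count_space UNIV"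
  shows "(\<lambda>\<omega>. activate_config (\<tau> \<omega>) (c \<omega>)) \<in> M \<rightarrow>\<^sub>M config_space"
proof (rule measurable_config_spaceI)
  fix q :: "'d particle"
  obtain x j where q: "q = (x, j)" by (cases q)
  let ?F = "\<lambda>s b1 b2 t. case s of Sleeping \<Rightarrow> if b1 \<and> b2 then Active t x 0 0
      else if b1 then Active Type1 x 0 0 else if b2 then Active Type2 x 0 0 else Sleeping | s \<Rightarrow> s"
  have "(\<lambda>\<omega>. (\<lambda>(s, b1) (b2, t). ?F s b1 b2 t)
      (c \<omega> q, occupied_by Type1 x (c \<omega>)) (occupied_by Type2 x (c \<omega>), \<tau> \<omega> x j)) \<in> M \<rightarrow>\<^sub>M count_space UNIV"
    by (rule measurable_count_space_binary[OF
        measurable_count_space_binary[where F = Pair, OF measurable_config_spaceD[OF c] measurable_occupied_by[OF c]]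
        measurable_count_space_binary[where F = Pair, OF measurable_occupied_by[OF c] \<tau>]])
  then show "(\<lambda>\<omega>. activate_config (\<tau> \<omega>) (c \<omega>) q) \<in> M \<rightarrow>\<^sub>M count_space UNIV"
    unfolding activate_config_def q prod.case .
qed

lemma frog_history_Suc:
  "frog_history p tie z \<omega> (Suc t) =
     (let h = frog_history p tie z \<omega> t;
          c = move_config p (fst (snd \<omega>)) (fst (snd (snd \<omega>))) (h t)
      in h(Suc t := activate_config (tie (snd (snd (snd \<omega>))) t h c) c))"
  by (cases \<omega>) simp

text \<open>The induction carries the whole history because the tie-breaking rule may depend on all
  of it.\<close>

lemma measurable_frog_history:
  fixes tie :: "('d::finite, 'u) tie_rule"
  assumes "tie_breaking_rule N tie"
  shows "(\<lambda>\<omega>. frog_history p tie z \<omega> t) \<in> frog_space \<nu> N \<rightarrow>\<^sub>M (\<Pi>\<^sub>M s\<in>{..t}. config_space)"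
proof (induction t)
  case 0
  have "frog_history p tie z \<omega> 0 = (\<lambda>s\<in>{..0}. initial_config (fst \<omega>) z)" for \<omega>
    by (cases \<omega>) simp
  then show ?case
    by (simp only:) (intro measurable_restrict measurable_initial_config)
next
  case (Suc t)
  let ?M = "frog_space \<nu> N :: ('d, 'u) sample measure"
  let ?h = "\<lambda>\<omega>. frog_history p tie z \<omega> t"
  let ?c = "\<lambda>\<omega>. move_config p (fst (snd \<omega>)) (fst (snd (snd \<omega>))) (?h \<omega> t)"
  have "(\<lambda>\<omega>. ?h \<omega> t) \<in> ?M \<rightarrow>\<^sub>M config_space"
    by (rule measurable_compose[OF Suc measurable_component_singleton]) simp
  then have c: "?c \<in> ?M \<rightarrow>\<^sub>M config_space" by (rule measurable_move_config)
  have "(\<lambda>\<omega>. (snd (snd (snd \<omega>)), ?h \<omega>, ?c \<omega>))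
      \<in> ?M \<rightarrow>\<^sub>M N \<Otimes>\<^sub>M (\<Pi>\<^sub>M s\<in>{..t}. config_space) \<Otimes>\<^sub>M config_space"
    by (intro measurable_Pair measurable_extra_randomness Suc c)
  note args = this
  have "(\<lambda>(u, h, c). tie u t h c x j)
      \<in> N \<Otimes>\<^sub>M (\<Pi>\<^sub>M s\<in>{..t}. config_space) \<Otimes>\<^sub>M config_space \<rightarrow>\<^sub>M count_space UNIV" for x j
    using assms unfolding tie_breaking_rule_def by blast
  from measurable_compose[OF args this]
  have "(\<lambda>\<omega>. tie (snd (snd (snd \<omega>))) t (?h \<omega>) (?c \<omega>) x j) \<in> ?M \<rightarrow>\<^sub>M count_space UNIV" for x j
    unfolding prod.case .
  then have "(\<lambda>\<omega>. activate_config (tie (snd (snd (snd \<omega>))) t (?h \<omega>) (?c \<omega>)) (?c \<omega>)) \<in> ?M \<rightarrow>\<^sub>M config_space"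
    by (intro measurable_activate_config c)
  then show ?case
    unfolding frog_history_Suc Let_def
    by (intro measurable_fun_upd[where J = "{..t}"] Suc) (auto simp: atMost_Suc)
qed

lemma measurable_frog_process:
  fixes tie :: "('d::finite, 'u) tie_rule"
  assumes "tie_breaking_rule N tie"
  shows "(\<lambda>\<omega>. frog_process p tie z \<omega> t q) \<in> frog_space \<nu> N \<rightarrow>\<^sub>M count_space UNIV"
  unfolding frog_process_def
  by (intro measurable_config_spaceD measurable_compose[OF measurable_frog_history[OF assms]
        measurable_component_singleton]) simp

text \<open>Expresses infinitude by countable quantifiers, which makes infinite growth a measurable
  event.\<close>

lemma infinite_iff_unbounded_to_nat:
  "infinite A \<longleftrightarrow> (\<forall>n. \<exists>q. n \<le> to_nat q \<and> q \<in> (A :: 'a :: countable set))"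
proof -
  have "infinite A \<longleftrightarrow> infinite (to_nat ` A)" by (simp add: finite_image_iff)
  also have "\<dots> \<longleftrightarrow> (\<forall>n. \<exists>q. n \<le> to_nat q \<and> q \<in> A)"
    unfolding infinite_nat_iff_unbounded_le by blast
  finally show ?thesis .
qed

lemma measurable_infinite_growth:
  fixes tie :: "('d::finite, 'u) tie_rule"
  assumes "tie_breaking_rule N tie"
  shows "(\<lambda>\<omega>. infinite_growth p tie z i \<omega>) \<in> frog_space \<nu> N \<rightarrow>\<^sub>M count_space UNIV"
proof -
  have "(\<lambda>\<omega>. frog_process p tie z \<omega> t q = s) \<in> frog_space \<nu> N \<rightarrow>\<^sub>M count_space UNIV" for t q s
    by (rule measurable_compose[OF measurable_frog_process[OF assms]]) simp
  then show ?thesis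
    unfolding infinite_growth_def infinite_iff_unbounded_to_nat activated_by_def mem_Collect_eq
    by measurable
qed

section \<open>Independent discrete coordinates\<close>

locale independent_observables = prob_space M for M :: "'a measure" +
  fixes X :: "'c \<Rightarrow> 'a \<Rightarrow> nat"
  assumes indep: "indep_vars (\<lambda>_. count_space UNIV) X UNIV"
begin

definition events_of :: "'c \<Rightarrow> 'a set set" where
  "events_of c = {X c -` A \<inter> space M | A. A \<in> sets (count_space UNIV)}"

text \<open>The sigma-algebra generated by the coordinates in \<open>J\<close>. Independence of two
  events then reduces to finding disjoint index sets for them.\<close>

definition sub :: "'c set \<Rightarrow> 'a measure" where
  "sub J = sigma (space M) (\<Union>c\<in>J. events_of c)"

lemma space_sub [simp]: "space (sub J) = space M"
  unfolding sub_def by (rule space_measure_of) (auto simp: events_of_def)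

lemma sets_sub: "sets (sub J) = sigma_sets (space M) (\<Union>c\<in>J. events_of c)"
  unfolding sub_def by (rule sets_measure_of) (auto simp: events_of_def)

lemma sets_sub_subset: "sets (sub J) \<subseteq> events"
proof -
  have "events_of c \<subseteq> events" for c
    using indep unfolding indep_vars_def2 events_of_def by (auto intro: measurable_sets)
  then show ?thesis unfolding sets_sub by (intro sets.sigma_sets_subset) blast
qed

lemma measurable_sub: "c \<in> J \<Longrightarrow> X c \<in> sub J \<rightarrow>\<^sub>M count_space UNIV"
  by (rule measurableI) (auto simp: sets_sub events_of_def intro!: sigma_sets.Basic)

text \<open>Independent variables grouped into disjoint blocks generate independent sigma-algebras.
  The intersection is written as a comprehension over \<open>space M\<close> so that an empty
  \<open>K\<close> gives the whole space.\<close>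

lemma prob_Inter_blocks:
  assumes "disjoint_family_on I K" "finite K" "\<And>k. k \<in> K \<Longrightarrow> A k \<in> sets (sub (I k))"
  shows "prob {\<omega> \<in> space M. \<forall>k\<in>K. \<omega> \<in> A k} = (\<Prod>k\<in>K. prob (A k))"
proof (cases "K = {}")
  case False
  have "indep_sets events_of UNIV"
    using indep unfolding indep_vars_def2 events_of_def by simp
  then have "indep_sets events_of (\<Union>k\<in>K. I k)" by (rule indep_sets_mono_index[rotated]) simp
  then have "indep_sets (\<lambda>k. sigma_sets (space M) (\<Union>c\<in>I k. events_of c)) K"
  proof (rule indep_sets_collect_sigma)
    show "Int_stable (events_of c)" for c
    proof (rule Int_stableI)
      fix a b assume "a \<in> events_of c" "b \<in> events_of c"
      then obtain A B where "a = X c -` A \<inter> space M" "b = X c -` B \<inter> space M"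
        by (auto simp: events_of_def)
      then have "a \<inter> b = X c -` (A \<inter> B) \<inter> space M" by blast
      then show "a \<inter> b \<in> events_of c"
        unfolding events_of_def by (intro CollectI exI[of _ "A \<inter> B"]) auto
    qed
  qed fact
  from indep_setsD[OF this order_refl False assms(2), of A] assms(3)
  have "prob (\<Inter>k\<in>K. A k) = (\<Prod>k\<in>K. prob (A k))" by (simp add: sets_sub)
  moreover have "A k \<subseteq> space M" if "k \<in> K" for k
    using assms(3)[OF that] sets.sets_into_space[of "A k" "sub (I k)"] by simp
  then have "(\<Inter>k\<in>K. A k) = {\<omega> \<in> space M. \<forall>k\<in>K. \<omega> \<in> A k}"
    using False by blast
  ultimately show ?thesis by simp
qed (simp add: prob_space)

lemma prob_Int_blocks:
  assumes "J \<inter> J' = {}" "A \<in> sets (sub J)" "B \<in> sets (sub J')"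
  shows "prob (A \<inter> B) = prob A * prob B"
proof -
  have "prob {\<omega> \<in> space M. \<forall>b\<in>UNIV. \<omega> \<in> (if b then A else B)} = (\<Prod>b\<in>UNIV. prob (if b then A else B))"
    by (rule prob_Inter_blocks[where I = "\<lambda>b. if b then J else J'"])
       (use assms in \<open>auto simp: disjoint_family_on_def\<close>)
  also have "{\<omega> \<in> space M. \<forall>b\<in>UNIV. \<omega> \<in> (if b then A else B)} = A \<inter> B"
    using sets.sets_into_space[OF assms(2)] by (auto simp: UNIV_bool)
  finally show ?thesis by (simp add: UNIV_bool)
qed

lemma measurable_sub_list:
  assumes "\<And>k. k < n \<Longrightarrow> c k \<in> J"
  shows "(\<lambda>\<omega>. map (\<lambda>k. X (c k) \<omega>) [0..<n]) \<in> sub J \<rightarrow>\<^sub>M count_space UNIV"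
  using assms
proof (induction n)
  case (Suc n)
  then have "(\<lambda>\<omega>. map (\<lambda>k. X (c k) \<omega>) [0..<n]) \<in> sub J \<rightarrow>\<^sub>M count_space UNIV" by simp
  from measurable_count_space_binary[OF this measurable_sub[of "c n" J], of "\<lambda>xs x. xs @ [x]"] Suc.prems
  show ?case by simp
qed simp

end

section \<open>The discrete coordinates of the sample space and their product law\<close>

datatype 'd coord = Number "'d site" | Increment "'d particle" nat | Wait "'d particle" nat nat

text \<open>Only the indicators \<open>L \<le> r\<close> are recorded, where \<open>r\<close> is the jump probability of the
  winning type, so that all coordinates are discrete.\<close>
definition obs :: "real \<Rightarrow> 'd coord \<Rightarrow> ('d::finite, 'u) sample \<Rightarrow> nat" where
  "obs r c \<omega> = (case c of Number y \<Rightarrow> fst \<omega> y | Increment q m \<Rightarrow> to_nat (fst (snd \<omega>) (q, m))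
     | Wait q m k \<Rightarrow> of_bool (fst (snd (snd \<omega>)) (q, m, k) \<le> r))"

definition obs_law :: "nat pmf \<Rightarrow> real \<Rightarrow> 'd::finite coord \<Rightarrow> nat pmf" where
  "obs_law \<nu> r c = (case c of Number y \<Rightarrow> \<nu>
     | Increment q m \<Rightarrow> map_pmf to_nat (pmf_of_set (unit_steps :: 'd site set))
     | Wait q m k \<Rightarrow> map_pmf of_bool (bernoulli_pmf r))"

lemma measurable_obs: "obs r c \<in> frog_space \<nu> N \<rightarrow>\<^sub>M count_space UNIV"
proof (cases c)
  case (Number y)
  then show ?thesis using measurable_initial_number[of y \<nu> N] by (simp add: obs_def[abs_def])
next
  case (Increment q m)
  then show ?thesis using measurable_compose[OF measurable_increment[of "(q, m)" \<nu> N], of to_nat]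
    by (simp add: obs_def[abs_def])
next
  case (Wait q m k)
  have "(\<lambda>\<omega>. of_bool (fst (snd (snd \<omega>)) (q, m, k) \<le> r)) \<in> frog_space \<nu> N \<rightarrow>\<^sub>M count_space (UNIV :: nat set)"
    using measurable_waiting_variable[of "(q, m, k)" \<nu> N] by measurable
  with Wait show ?thesis by (simp add: obs_def[abs_def])
qed

text \<open>The indicator of \<open>x \<le> r\<close> under the uniform law is Bernoulli with
  parameter \<open>r\<close>; only whether \<open>B\<close> contains 0 and 1 matters, which leaves
  four cases.\<close>

lemma emeasure_wait_indicator:
  assumes "0 \<le> r" "r \<le> 1"
  shows "emeasure (uniform_measure lborel {0..1 :: real}) {x. of_bool (x \<le> r) \<in> B}
    = emeasure (map_pmf of_bool (bernoulli_pmf r)) (B :: nat set)"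
proof -
  let ?U = "uniform_measure lborel {0..1 :: real}"
  interpret U: prob_space ?U by (rule prob_space_uniform_measure) auto
  have le: "emeasure ?U {..r} = ennreal r"
  proof -
    have "{0..1} \<inter> {..r} = {0..r}" using assms by auto
    then show ?thesis using assms by (simp add: divide_ennreal_def)
  qed
  have gt: "emeasure ?U {r<..} = ennreal (1 - r)"
  proof -
    have "{0..1} \<inter> {r<..} = {r<..1}" using assms by auto
    then show ?thesis using assms by (simp add: divide_ennreal_def)
  qed
  have *: "{x. of_bool (x \<le> r) \<in> B}
      = (if 1 \<in> B then if 0 \<in> B then UNIV else {..r} else if 0 \<in> B then {r<..} else {})"
    by (auto simp: of_bool_def split: if_splits)
  have vim: "of_bool -` B = (if 1 \<in> B then if 0 \<in> B then UNIV else {True} else if 0 \<in> B then {False} else {})"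
    by (auto simp: of_bool_def split: if_splits)
  have "emeasure ?U UNIV = 1" using U.emeasure_space_1 by simp
  then show ?thesis
    unfolding * using le gt
    by (auto simp: vim assms emeasure_pmf_single simp del: emeasure_uniform_measure)
qed

context
  fixes \<nu> :: "nat pmf" and N :: "'u measure" and r :: real
  assumes N: "prob_space N" and r: "0 \<le> r" "r \<le> 1"
begin

text \<open>A cylinder over finitely many coordinates is a rectangle in the fourfold product, and
  each of the three coordinate families is itself a product; the factor for the tie-breaking
  randomness is 1.\<close>

lemma prob_obs:
  fixes J :: "'d::finite coord set"
  assumes "finite J"
  shows "measure (frog_space \<nu> N) {\<omega> \<in> space (frog_space \<nu> N). \<forall>c\<in>J. obs r c \<omega> \<in> B c}
    = (\<Prod>c\<in>J. measure_pmf.prob (obs_law \<nu> r c) (B c))"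
proof -
  let ?U = "uniform_measure lborel {0..1 :: real}"
  let ?P1 = "\<Pi>\<^sub>M x\<in>(UNIV :: 'd site set). measure_pmf \<nu>"
  let ?P2 = "\<Pi>\<^sub>M qn\<in>(UNIV :: ('d particle \<times> nat) set). measure_pmf (pmf_of_set (unit_steps :: 'd site set))"
  let ?P3 = "\<Pi>\<^sub>M qnk\<in>(UNIV :: ('d particle \<times> nat \<times> nat) set). ?U"
  interpret N: prob_space N by (rule N)
  have U: "prob_space ?U" by (rule prob_space_uniform_measure) auto
  interpret P1: product_prob_space "\<lambda>x. measure_pmf \<nu>" "UNIV :: 'd site set"
    by unfold_locales
  interpret P2: product_prob_space "\<lambda>x. measure_pmf (pmf_of_set (unit_steps :: 'd site set))"
    "UNIV :: ('d particle \<times> nat) set"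
    by unfold_locales
  interpret P3: product_prob_space "\<lambda>x. ?U" "UNIV :: ('d particle \<times> nat \<times> nat) set"
    using U by (intro product_prob_space.intro product_prob_space_axioms.intro product_sigma_finite.intro)
      (auto intro: prob_space_imp_sigma_finite)
  interpret P3N: prob_space "?P3 \<Otimes>\<^sub>M N"
    by (intro prob_space_pair P3.P.prob_space_axioms N)
  interpret P2N: prob_space "?P2 \<Otimes>\<^sub>M ?P3 \<Otimes>\<^sub>M N"
    by (intro prob_space_pair P2.P.prob_space_axioms P3N.prob_space_axioms)
  interpret F: prob_space "frog_space \<nu> N :: ('d, 'u) sample measure" by (rule prob_space_frog_space[OF N])
  define J1 where "J1 = Number -` J"
  define J2 where "J2 = (\<lambda>(q, m). Increment q m) -` J"
  define J3 where "J3 = (\<lambda>(q, m, k). Wait q m k) -` J"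
  have fin: "finite J1" "finite J2" "finite J3"
    unfolding J1_def J2_def J3_def using assms by (auto intro!: finite_vimageI simp: inj_def)
  have J: "J = Number ` J1 \<union> ((\<lambda>(q, m). Increment q m) ` J2 \<union> (\<lambda>(q, m, k). Wait q m k) ` J3)"
  proof -
    have "c \<in> Number ` J1 \<union> ((\<lambda>(q, m). Increment q m) ` J2 \<union> (\<lambda>(q, m, k). Wait q m k) ` J3)"
      if "c \<in> J" for c
    proof (cases c)
      case (Wait q m k)
      with that have "(q, m, k) \<in> J3" by (simp add: J3_def)
      with Wait show ?thesis by force
    qed (use that in \<open>force simp: J1_def J2_def\<close>)+
    then show ?thesis by (auto simp: J1_def J2_def J3_def)
  qed
  define A1 where "A1 = {f \<in> space ?P1. \<forall>y\<in>J1. f y \<in> B (Number y)}"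
  define A2 where "A2 = {f \<in> space ?P2. \<forall>qm\<in>J2. f qm \<in> to_nat -` B (case qm of (q, m) \<Rightarrow> Increment q m)}"
  define A3 where "A3 = {f \<in> space ?P3. \<forall>qmk\<in>J3. f qmk \<in> {x. of_bool (x \<le> r) \<in> B (case qmk of (q, m, k) \<Rightarrow> Wait q m k)}}"
  have sets3: "{x. of_bool (x \<le> r) \<in> C} \<in> sets ?U" for C :: "nat set"
  proof -
    have "(\<lambda>x. of_bool (x \<le> r) :: nat) \<in> borel \<rightarrow>\<^sub>M count_space UNIV" by measurable
    from measurable_sets[OF this, of C] show ?thesis by (simp add: vimage_def)
  qed
  have sets_A: "A1 \<in> sets ?P1" "A2 \<in> sets ?P2" "A3 \<in> sets ?P3"
  proof -
    show "A1 \<in> sets ?P1" "A2 \<in> sets ?P2"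
      unfolding A1_def A2_def
      by (intro sets.sets_Collect_finite_All fin sets_Collect_single'; simp)+
    show "A3 \<in> sets ?P3" unfolding A3_def
    proof (intro sets.sets_Collect_finite_All fin)
      fix qmk assume "qmk \<in> J3"
      show "{f \<in> space ?P3. f qmk \<in> {x. of_bool (x \<le> r) \<in> B (case qmk of (q, m, k) \<Rightarrow> Wait q m k)}} \<in> sets ?P3"
        by (intro sets_Collect_single' sets3) auto
    qed
  qed
  have "(\<forall>c\<in>J. obs r c \<omega> \<in> B c) \<longleftrightarrow> (\<forall>y\<in>J1. fst \<omega> y \<in> B (Number y))
      \<and> (\<forall>qm\<in>J2. to_nat (fst (snd \<omega>) qm) \<in> B (case qm of (q, m) \<Rightarrow> Increment q m))
      \<and> (\<forall>qmk\<in>J3. of_bool (fst (snd (snd \<omega>)) qmk \<le> r) \<in> B (case qmk of (q, m, k) \<Rightarrow> Wait q m k))"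
    for \<omega> :: "('d, 'u) sample"
    unfolding J ball_Un ball_simps by (simp add: obs_def split_beta)
  then have "{\<omega> \<in> space (frog_space \<nu> N). \<forall>c\<in>J. obs r c \<omega> \<in> B c} = A1 \<times> A2 \<times> A3 \<times> space N"
    unfolding A1_def A2_def A3_def space_frog_space space_PiM by auto
  then have "emeasure (frog_space \<nu> N) {\<omega> \<in> space (frog_space \<nu> N). \<forall>c\<in>J. obs r c \<omega> \<in> B c}
      = emeasure ?P1 A1 * (emeasure ?P2 A2 * (emeasure ?P3 A3 * emeasure N (space N)))"
    unfolding frog_space_def using sets_A
    by (simp add: P2N.emeasure_pair_measure_Times P3N.emeasure_pair_measure_Times
        N.emeasure_pair_measure_Times)
  also have "emeasure N (space N) = 1" by (rule N.emeasure_space_1)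
  also have "emeasure ?P1 A1 = (\<Prod>c\<in>Number ` J1. emeasure (obs_law \<nu> r c) (B c))"
    unfolding A1_def by (subst P1.emeasure_PiM_Collect) (auto simp: fin prod.reindex inj_on_def obs_law_def)
  also have "emeasure ?P2 A2 = (\<Prod>c\<in>(\<lambda>(q, m). Increment q m) ` J2. emeasure (obs_law \<nu> r c) (B c))"
  proof -
    have "emeasure ?P2 A2 = (\<Prod>qm\<in>J2. emeasure (measure_pmf (pmf_of_set (unit_steps :: 'd site set)))
        (to_nat -` B (case qm of (q, m) \<Rightarrow> Increment q m)))"
      unfolding A2_def by (rule P2.emeasure_PiM_Collect) (use fin in auto)
    also have "\<dots> = (\<Prod>c\<in>(\<lambda>(q, m). Increment q m) ` J2. emeasure (obs_law \<nu> r c) (B c))"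
      by (subst prod.reindex) (auto simp: inj_on_def obs_law_def intro!: prod.cong)
    finally show ?thesis .
  qed
  also have "emeasure ?P3 A3 = (\<Prod>c\<in>(\<lambda>(q, m, k). Wait q m k) ` J3. emeasure (obs_law \<nu> r c) (B c))"
  proof -
    have "emeasure ?P3 A3 = (\<Prod>qmk\<in>J3. emeasure ?U {x. of_bool (x \<le> r) \<in> B (case qmk of (q, m, k) \<Rightarrow> Wait q m k)})"
      unfolding A3_def by (rule P3.emeasure_PiM_Collect) (use fin sets3 in auto)
    also have "\<dots> = (\<Prod>c\<in>(\<lambda>(q, m, k). Wait q m k) ` J3. emeasure (obs_law \<nu> r c) (B c))"
      by (subst prod.reindex)
         (auto simp: inj_on_def obs_law_def emeasure_wait_indicator[OF r] intro!: prod.cong)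
    finally show ?thesis .
  qed
  also have "(\<Prod>c\<in>Number ` J1. emeasure (obs_law \<nu> r c) (B c))
      * ((\<Prod>c\<in>(\<lambda>(q, m). Increment q m) ` J2. emeasure (obs_law \<nu> r c) (B c))
      * ((\<Prod>c\<in>(\<lambda>(q, m, k). Wait q m k) ` J3. emeasure (obs_law \<nu> r c) (B c)) * 1))
      = (\<Prod>c\<in>J. emeasure (obs_law \<nu> r c) (B c))"
    unfolding J using fin by (subst prod.union_disjoint; (subst prod.union_disjoint)?) auto
  finally show ?thesis
    by (simp add: F.emeasure_eq_measure measure_pmf.emeasure_eq_measure prod_ennreal prod_nonneg)
qed

lemma prob_obs_single:
  "measure (frog_space \<nu> N) {\<omega> \<in> space (frog_space \<nu> N). obs r c \<omega> \<in> B}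
    = measure_pmf.prob (obs_law \<nu> r c) B"
  using prob_obs[of "{c}" "\<lambda>_. B"] by simp

lemma independent_observables:
  "independent_observables (frog_space \<nu> N :: ('d::finite, 'u) sample measure) (obs r)"
proof -
  interpret F: prob_space "frog_space \<nu> N :: ('d::finite, 'u) sample measure"
    by (rule prob_space_frog_space[OF N])
  let ?M = "frog_space \<nu> N :: ('d, 'u) sample measure"
  show "independent_observables ?M (obs r)"
  proof (intro independent_observables.intro independent_observables_axioms.intro F.prob_space_axioms)
    show "F.indep_vars (\<lambda>_. count_space UNIV) (obs r) UNIV"
      unfolding F.indep_vars_def2
    proof (intro conjI ballI F.indep_setsI)
      fix A :: "'d coord \<Rightarrow> ('d, 'u) sample set" and J :: "'d coord set"
      assume J: "J \<noteq> {}" "finite J"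
        and A: "\<forall>c\<in>J. A c \<in> {obs r c -` B \<inter> space ?M |B. B \<in> sets (count_space UNIV)}"
      from A have "\<forall>c\<in>J. \<exists>B. A c = obs r c -` B \<inter> space ?M" by blast
      from bchoice[OF this] obtain B where B: "\<And>c. c \<in> J \<Longrightarrow> A c = obs r c -` B c \<inter> space ?M" by blast
      have "(\<Inter>c\<in>J. A c) = {\<omega> \<in> space ?M. \<forall>c\<in>J. obs r c \<omega> \<in> B c}"
        using B J by auto
      then have "F.prob (\<Inter>c\<in>J. A c) = (\<Prod>c\<in>J. measure_pmf.prob (obs_law \<nu> r c) (B c))"
        using prob_obs[OF J(2)] by simp
      also have "\<dots> = (\<Prod>c\<in>J. F.prob (A c))"
      proof (intro prod.cong refl)
        fix c assume "c \<in> J"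
        then have "A c = {\<omega> \<in> space ?M. obs r c \<omega> \<in> B c}" using B by blast
        then show "measure_pmf.prob (obs_law \<nu> r c) (B c) = F.prob (A c)"
          by (simp only: prob_obs_single)
      qed
      finally show "F.prob (\<Inter>c\<in>J. A c) = (\<Prod>c\<in>J. F.prob (A c))" .
    next
      fix c :: "'d coord"
      show "{obs r c -` B \<inter> space ?M |B. B \<in> sets (count_space UNIV)} \<subseteq> F.events"
        using measurable_sets[OF measurable_obs[of r c \<nu> N]] by blast
    qed (rule measurable_obs)
  qed
qed

end

section \<open>Probability estimates\<close>

text \<open>The vector \<open>v\<close> points away from \<open>w\<close> in every coordinate, so
  passing from \<open>x\<close> to \<open>x - v\<close> moves towards \<open>w\<close>. Coordinate
  \<open>a\<close> has distance \<open>\<rho> + 1\<close> from \<open>w\<close> and drops by between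
  1 and \<open>n\<close>: enough to enter the old cube in this direction, but not its inner
  half.\<close>

lemma inward_targets:
  fixes x v w :: "int ^ 'd::finite"
  assumes x: "x \<in> cube w (Suc \<rho>)" and a: "a \<in> outside w \<rho> x"
    and v: "v \<in> orthant (\<lambda>j. x $ j \<ge> w $ j) a" "\<And>j. \<bar>v $ j\<bar> \<le> int n"
    and n: "n \<le> \<rho> div 2"
  shows "x - v \<in> cube w (Suc \<rho>)" "x - v \<notin> cube w (\<rho> div 2)" "outside w \<rho> (x - v) \<subset> outside w \<rho> x"
proof -
  have n': "2 * int n \<le> int \<rho>" using n by linarith
  have xj: "\<bar>x $ j - w $ j\<bar> \<le> int \<rho> + 1" for j using x by (simp add: cube_def add.commute)
  have vj: "if x $ j \<ge> w $ j then v $ j \<ge> 0 else v $ j \<le> 0" for j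
    using v(1) unfolding orthant_def mem_Collect_eq by blast
  \<comment> \<open>The second term of the maximum covers a coordinate that overshoots
    \<open>w\<close>.\<close>
  have inward: "\<bar>(x - v) $ j - w $ j\<bar> \<le> max \<bar>x $ j - w $ j\<bar> (int n)" for j
    using vj[of j] v(2)[of j] by (auto split: if_splits)
  have xa: "\<bar>x $ a - w $ a\<bar> = int \<rho> + 1" using a xj[of a] by (simp add: outside_def)
  have va: "v $ a \<noteq> 0" using v(1) by (simp add: orthant_def)
  show "x - v \<in> cube w (Suc \<rho>)"
    unfolding cube_def mem_Collect_eq
  proof
    fix j
    show "\<bar>(x - v) $ j - w $ j\<bar> \<le> int (Suc \<rho>)" using inward[of j] xj[of j] n' by simp
  qed
  have far: "\<bar>(x - v) $ a - w $ a\<bar> \<ge> int \<rho> + 1 - int n" using xa v(2)[of a] by simp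
  then have "\<not> \<bar>(x - v) $ a - w $ a\<bar> \<le> int (\<rho> div 2)" using n' by (simp add: zdiv_int)
  then show "x - v \<notin> cube w (\<rho> div 2)" by (auto simp: cube_def)
  have "outside w \<rho> (x - v) \<subseteq> outside w \<rho> x"
  proof
    fix j assume "j \<in> outside w \<rho> (x - v)"
    then show "j \<in> outside w \<rho> x" using inward[of j] n' by (simp add: outside_def)
  qed
  moreover have "a \<notin> outside w \<rho> (x - v)"
    using xa va vj[of a] v(2)[of a] n' by (auto simp: outside_def split: if_splits)
  ultimately show "outside w \<rho> (x - v) \<subset> outside w \<rho> x" using a by blast
qed

lemma finite_cube [simp]: "finite (cube w \<rho>)"
  and card_cube_le: "card (cube (w :: int ^ 'd::finite) \<rho>) \<le> (2 * \<rho> + 1) ^ CARD('d)"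
proof -
  let ?P = "\<Pi>\<^sub>E j\<in>(UNIV :: 'd set). {w $ j - int \<rho>..w $ j + int \<rho>}"
  have fin: "finite ?P" by (intro finite_PiE) auto
  have sub: "cube w \<rho> \<subseteq> vec_lambda ` ?P"
  proof
    fix v assume v: "v \<in> cube w \<rho>"
    have "v $ j \<in> {w $ j - int \<rho>..w $ j + int \<rho>}" for j
    proof -
      have "\<bar>v $ j - w $ j\<bar> \<le> int \<rho>" using v by (simp add: cube_def)
      then show ?thesis by auto
    qed
    then have "vec_nth v \<in> ?P" by blast
    moreover have "v = vec_lambda (vec_nth v)" by simp
    ultimately show "v \<in> vec_lambda ` ?P" by blast
  qed
  show "finite (cube w \<rho>)" by (rule finite_subset[OF sub]) (intro finite_imageI fin)
  have "card (cube w \<rho>) \<le> card ?P"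
    using card_mono[OF finite_imageI[OF fin] sub] card_image_le[OF fin, of vec_lambda] by linarith
  also have "card ?P = (2 * \<rho> + 1) ^ CARD('d)"
    by (simp add: card_PiE nat_add_distrib nat_mult_distrib)
  finally show "card (cube w \<rho>) \<le> (2 * \<rho> + 1) ^ CARD('d)" .
qed

lemma finite_bounded_vectors: "finite {v :: int ^ 'd::finite. \<forall>j. \<bar>v $ j\<bar> \<le> int n}"
  using finite_cube[of "0 :: int ^ 'd" n] by (simp add: cube_def)

text \<open>The offset \<open>s\<close> allows statements about a losing particle after its first
  \<open>M0\<close> prescribed jumps.\<close>

definition block :: "'d::finite particle \<Rightarrow> nat \<Rightarrow> nat \<Rightarrow> ('d, 'u) sample \<Rightarrow> 'd site list" where
  "block q s n \<omega> = map (\<lambda>k. fst (snd \<omega>) (q, s + k)) [0..<n]"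

lemma length_block [simp]: "length (block q s n \<omega>) = n"
  by (simp add: block_def)

lemma take_block: "m \<le> n \<Longrightarrow> take m (block q s n \<omega>) = block q s m \<omega>"
  by (simp add: block_def take_map)

lemma walk_path_split:
  "walk_path (fst (snd \<omega>)) q (s + n) = walk_path (fst (snd \<omega>)) q s + sum_list (block q s n \<omega>)"
  by (induction n) (auto simp: walk_path_def block_def add.assoc)

lemma visited_block:
  "v \<in> visited (block q s n \<omega>) \<longleftrightarrow> (\<exists>m\<le>n. walk_path (fst (snd \<omega>)) q (s + m) = walk_path (fst (snd \<omega>)) q s + v)"
  unfolding walk_path_split by (auto simp: visited_def take_block)

locale frog_estimates =
  fixes \<nu> :: "nat pmf" and N :: "'u measure" and r :: real and w :: "'d::finite site"
  assumes N: "prob_space N" and r: "0 < r" "r \<le> 1"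
begin

abbreviation M :: "('d, 'u) sample measure" where
  "M \<equiv> frog_space \<nu> N"

sublocale independent_observables M "obs r"
  by (rule independent_observables[OF N]) (use r in auto)

lemmas obs_probs = prob_obs[OF N less_imp_le[OF r(1)] r(2), where \<nu> = \<nu>]

definition occupation :: real where
  "occupation = measure_pmf.prob \<nu> {1..}"

lemma measurable_block:
  assumes "\<And>k. k < n \<Longrightarrow> Increment q (s + k) \<in> J"
  shows "block q s n \<in> sub J \<rightarrow>\<^sub>M count_space UNIV"
proof -
  have "(\<lambda>\<omega>. map (from_nat :: nat \<Rightarrow> 'd site) (map (\<lambda>k. obs r (Increment q (s + k)) \<omega>) [0..<n])) \<in> sub J \<rightarrow>\<^sub>M count_space UNIV"
    by (rule measurable_compose[OF measurable_sub_list]) (use assms in auto)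
  then show ?thesis by (simp add: obs_def block_def[abs_def] o_def)
qed

lemma block_events:
  assumes "\<And>k. k < n \<Longrightarrow> Increment q (s + k) \<in> J"
  shows "{\<omega> \<in> space M. Q (block q s n \<omega>)} \<in> sets (sub J)"
  using measurable_sets[OF measurable_block[OF assms], of n "{xs. Q xs}"]
  by (simp add: vimage_def Int_def conj_commute)

lemma prob_block_eq:
  assumes "xs \<in> step_lists n"
  shows "prob {\<omega> \<in> space M. block q s n \<omega> = xs} = 1 / real (2 * CARD('d)) ^ n"
proof -
  let ?J = "(\<lambda>k. Increment q (s + k)) ` {..<n}"
  \<comment> \<open>Only increments occur in \<open>?J\<close>, so the empty default is never
    evaluated.\<close>
  let ?B = "\<lambda>c. case c of Increment q m \<Rightarrow> {to_nat (xs ! (m - s))} | _ \<Rightarrow> {}"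
  have len: "length xs = n" and steps: "\<And>k. k < n \<Longrightarrow> xs ! k \<in> unit_steps"
    using assms by (auto simp: step_lists_def)
  have "{\<omega> \<in> space M. block q s n \<omega> = xs} = {\<omega> \<in> space M. \<forall>c\<in>?J. obs r c \<omega> \<in> ?B c}"
    by (auto simp: obs_def block_def list_eq_iff_nth_eq len)
  then have "prob {\<omega> \<in> space M. block q s n \<omega> = xs} = (\<Prod>c\<in>?J. measure_pmf.prob (obs_law \<nu> r c) (?B c))"
    by (simp only: obs_probs finite_imageI finite_lessThan)
  also have "\<dots> = (\<Prod>k<n. measure_pmf.prob (map_pmf to_nat (pmf_of_set (unit_steps :: 'd site set))) {to_nat (xs ! k)})"
    by (subst prod.reindex) (auto simp: inj_on_def obs_law_def)
  also have "\<dots> = (\<Prod>k<n. 1 / real (2 * CARD('d)))"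
  proof (intro prod.cong refl)
    fix k assume "k \<in> {..<n}"
    have "to_nat -` {to_nat (xs ! k)} = {xs ! k}" by auto
    then show "measure_pmf.prob (map_pmf to_nat (pmf_of_set (unit_steps :: 'd site set))) {to_nat (xs ! k)}
        = 1 / real (2 * CARD('d))"
      unfolding measure_map_pmf
      using steps \<open>k \<in> {..<n}\<close> by (simp add: measure_pmf_single card_unit_steps)
  qed
  finally show ?thesis by (simp add: power_divide)
qed

text \<open>The lists of unit steps together carry mass one, so all other values of the block may be
  ignored and the probability is a normalised count.\<close>

lemma prob_block:
  "prob {\<omega> \<in> space M. Q (block q s n \<omega>)} = walk_mean n (\<lambda>xs. of_bool (Q xs))"
proof -
  let ?E = "\<lambda>xs. {\<omega> \<in> space M. block q s n \<omega> = xs}"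
  have E: "?E xs \<in> events" for xs
    using block_events[of n q s UNIV "\<lambda>ys. ys = xs"] sets_sub_subset by auto
  have finite: "prob {\<omega> \<in> space M. block q s n \<omega> \<in> A} = card A / real (2 * CARD('d)) ^ n"
    if "A \<subseteq> step_lists n" for A
  proof -
    have fin: "finite A" using that by (rule finite_subset) simp
    have "{\<omega> \<in> space M. block q s n \<omega> \<in> A} = (\<Union>xs\<in>A. ?E xs)" by auto
    also have "prob (\<Union>xs\<in>A. ?E xs) = (\<Sum>xs\<in>A. prob (?E xs))"
      using E by (intro finite_measure_finite_Union fin) (auto simp: disjoint_family_on_def)
    also have "\<dots> = (\<Sum>xs\<in>A. 1 / real (2 * CARD('d)) ^ n)"
      using that by (intro sum.cong refl prob_block_eq) auto
    finally show ?thesis by simp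
  qed
  let ?S = "{\<omega> \<in> space M. block q s n \<omega> \<in> step_lists n}"
  have meas: "{\<omega> \<in> space M. R (block q s n \<omega>)} \<in> events" for R
    using block_events[of n q s UNIV R] sets_sub_subset by auto
  have "prob ?S = 1" using finite[OF order_refl] by (simp add: card_step_lists)
  then have "AE \<omega> in M. \<omega> \<in> ?S" using meas by (subst AE_in_set_eq_1) auto
  then have "prob {\<omega> \<in> space M. Q (block q s n \<omega>)}
      = prob {\<omega> \<in> space M. block q s n \<omega> \<in> {xs \<in> step_lists n. Q xs}}"
    using meas by (intro finite_measure_eq_AE) auto
  also have "\<dots> = card {xs \<in> step_lists n. Q xs} / real (2 * CARD('d)) ^ n"
    by (rule finite) auto
  also have "\<dots> = walk_mean n (\<lambda>xs. of_bool (Q xs))"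
    by (simp add: walk_mean_def sum_of_bool_eq Int_def)
  finally show ?thesis .
qed

text \<open>The walk is indexed by its own jumps, whether or not the particle is ever activated. The
  event therefore depends only on the number and the increments at \<open>y\<close>, not on the
  dynamics.\<close>

definition hit :: "nat \<Rightarrow> 'd site \<Rightarrow> 'd site \<Rightarrow> ('d, 'u) sample set" where
  "hit n x y = {\<omega> \<in> space M. 1 \<le> fst \<omega> y \<and> x - y \<in> visited (block (y, 1) 0 n \<omega>)}"

lemma number_events:
  assumes "Number y \<in> J"
  shows "{\<omega> \<in> space M. 1 \<le> fst \<omega> y} \<in> sets (sub J)"
  using measurable_sets[OF measurable_sub[OF assms], of "{1..}"]
  by (simp add: vimage_def Int_def conj_commute obs_def)

lemma hit_events:
  assumes "Number y \<in> J" "\<And>k. k < n \<Longrightarrow> Increment (y, 1) k \<in> J"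
  shows "hit n x y \<in> sets (sub J)"
proof -
  have "hit n x y = {\<omega> \<in> space M. 1 \<le> fst \<omega> y} \<inter> {\<omega> \<in> space M. x - y \<in> visited (block (y, 1) 0 n \<omega>)}"
    by (auto simp: hit_def)
  with number_events[OF assms(1)] block_events[of n "(y, 1)" 0 J "\<lambda>xs. x - y \<in> visited xs"] assms(2)
  show ?thesis by auto
qed

lemma prob_hit:
  "prob (hit n x y) = occupation * walk_mean n (\<lambda>xs. of_bool (x - y \<in> visited xs))"
proof -
  let ?A = "{\<omega> \<in> space M. 1 \<le> fst \<omega> y}" and ?B = "{\<omega> \<in> space M. x - y \<in> visited (block (y, 1) 0 n \<omega>)}"
  have "hit n x y = ?A \<inter> ?B" by (auto simp: hit_def)
  also have "prob (?A \<inter> ?B) = prob ?A * prob ?B"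
    by (rule prob_Int_blocks[of "{Number y}" "range (Increment (y, 1))"];
        (intro number_events block_events)?; auto)
  also have "prob ?A = occupation"
    using obs_probs[of "{Number y}" "\<lambda>_. {1..}"] by (simp add: obs_def obs_law_def occupation_def)
  also have "prob ?B = walk_mean n (\<lambda>xs. of_bool (x - y \<in> visited xs))" by (rule prob_block)
  finally show ?thesis .
qed

text \<open>The possible starting sites inwards of \<open>x\<close>: the displacement
  \<open>v\<close> from \<open>y\<close> to \<open>x\<close> lies in the orthant that points away
  from \<open>w\<close>.\<close>

definition targets :: "nat \<Rightarrow> 'd site \<Rightarrow> 'd \<Rightarrow> 'd site set" where
  "targets n x a = (\<lambda>v. x - v) ` (orthant (\<lambda>j. x $ j \<ge> w $ j) a \<inter> {v. \<forall>j. \<bar>v $ j\<bar> \<le> int n})"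

text \<open>The lower bound of \<open>sum_hitting_probabilities_ge\<close> without its factor
  \<open>sqrt n\<close>, times the probability that a site is occupied.\<close>

definition hit_const :: real where
  "hit_const = occupation / (2 * real CARD('d) * sqrt (6 * real CARD('d)) * 2 ^ CARD('d))"

lemma finite_targets [simp]: "finite (targets n x a)"
  unfolding targets_def by (intro finite_imageI finite_Int disjI2 finite_bounded_vectors)

text \<open>Hits from different sites use disjoint coordinates and are independent, so the
  probability of none is a product of terms \<open>1 - q \<le> exp (- q)\<close>. The exponents add
  up to an expected number of hits, bounded below by the orthant estimate.\<close>

lemma prob_no_hit:
  "prob {\<omega> \<in> space M. \<forall>y\<in>targets n x a. \<omega> \<in> space M - hit n x y} \<le> exp (- (hit_const * sqrt (real n)))"
proof -
  let ?I = "\<lambda>y. insert (Number y) (range (Increment (y, 1)))"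
  let ?V = "orthant (\<lambda>j. x $ j \<ge> w $ j) a \<inter> {v. \<forall>j. \<bar>v $ j\<bar> \<le> int n}"
  have hit: "hit n x y \<in> sets (sub (?I y))" for y by (rule hit_events) auto
  have ev: "hit n x y \<in> events" for y using hit sets_sub_subset by blast
  have "prob {\<omega> \<in> space M. \<forall>y\<in>targets n x a. \<omega> \<in> space M - hit n x y}
      = (\<Prod>y\<in>targets n x a. prob (space M - hit n x y))"
  proof (rule prob_Inter_blocks[where I = ?I])
    show "disjoint_family_on ?I (targets n x a)" by (auto simp: disjoint_family_on_def)
    show "space M - hit n x y \<in> sets (sub (?I y))" for y
      using sets.compl_sets[OF hit[of y]] by simp
  qed simp
  also have "\<dots> \<le> (\<Prod>y\<in>targets n x a. exp (- prob (hit n x y)))"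
  proof (intro prod_mono conjI)
    fix y
    show "prob (space M - hit n x y) \<le> exp (- prob (hit n x y))"
      using exp_ge_add_one_self[of "- prob (hit n x y)"] prob_compl[OF ev[of y]] by simp
  qed simp
  also have "\<dots> = exp (- (\<Sum>y\<in>targets n x a. prob (hit n x y)))"
    unfolding sum_negf[symmetric] by (rule exp_sum[symmetric]) simp
  also have "(\<Sum>y\<in>targets n x a. prob (hit n x y)) = (\<Sum>v\<in>?V. prob (hit n x (x - v)))"
    unfolding targets_def by (subst sum.reindex) (auto simp: inj_on_def)
  also have "\<dots> = occupation * (\<Sum>v\<in>?V. walk_mean n (\<lambda>xs. of_bool (v \<in> visited xs)))"
    by (simp add: prob_hit sum_distrib_left)
  also have "exp (- \<dots>) \<le> exp (- (hit_const * sqrt (real n)))"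
  proof -
    have "occupation * (sqrt (real n) / (2 * real CARD('d) * sqrt (6 * real CARD('d)) * 2 ^ CARD('d)))
        \<le> occupation * (\<Sum>v\<in>?V. walk_mean n (\<lambda>xs. of_bool (v \<in> visited xs)))"
      by (intro mult_left_mono sum_hitting_probabilities_ge) (simp add: occupation_def)
    then show ?thesis by (simp add: hit_const_def)
  qed
  finally show ?thesis .
qed

section \<open>The ways in which a stage of the growth can fail\<close>

definition exit_axis :: "nat \<Rightarrow> 'd site \<Rightarrow> 'd" where
  "exit_axis \<rho> x = (SOME a. a \<in> outside w \<rho> x)"

definition no_spread :: "nat \<Rightarrow> nat \<Rightarrow> ('d, 'u) sample set" where
  "no_spread n \<rho> = (\<Union>x\<in>cube w (Suc \<rho>) - cube w \<rho>.
     {\<omega> \<in> space M. \<forall>y\<in>targets n x (exit_axis \<rho> x). \<omega> \<in> space M - hit n x y})"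

definition slow :: "nat \<Rightarrow> nat \<Rightarrow> nat \<Rightarrow> ('d, 'u) sample set" where
  "slow n K \<rho> = (\<Union>y\<in>cube w (Suc \<rho>) - cube w (\<rho> div 2). \<Union>m\<in>{..<n}.
     {\<omega> \<in> space M. \<forall>k\<in>{1..K}. obs r (Wait (y, 1) m k) \<omega> = 0})"

text \<open>Only half the radius is granted to the displacement after \<open>s\<close> jumps,
  because the position at that moment may already use up the other half.\<close>

definition escape :: "'d particle set \<Rightarrow> nat \<Rightarrow> nat \<Rightarrow> nat \<Rightarrow> ('d, 'u) sample set" where
  "escape P s B \<rho> = (\<Union>q\<in>P. \<Union>k\<in>{..B}. \<Union>a\<in>UNIV.
     {\<omega> \<in> space M. real \<rho> / 2 \<le> \<bar>real_of_int (sum_list (block q s k \<omega>) $ a)\<bar>})"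

lemma exit_axis: "x \<notin> cube w \<rho> \<Longrightarrow> exit_axis \<rho> x \<in> outside w \<rho> x"
  unfolding exit_axis_def by (rule someI_ex) (use outside_empty_iff in blast)

lemma targets_location:
  assumes "x \<in> cube w (Suc \<rho>) - cube w \<rho>" "n \<le> \<rho> div 2" "y \<in> targets n x (exit_axis \<rho> x)"
  shows "y \<in> cube w (Suc \<rho>)" "y \<notin> cube w (\<rho> div 2)" "outside w \<rho> y \<subset> outside w \<rho> x"
proof -
  from assms(3) obtain v where "y = x - v" "v \<in> orthant (\<lambda>j. x $ j \<ge> w $ j) (exit_axis \<rho> x)"
    "\<And>j. \<bar>v $ j\<bar> \<le> int n" by (auto simp: targets_def)
  with inward_targets[OF _ exit_axis _ _ assms(2), of x] assms(1)
  show "y \<in> cube w (Suc \<rho>)" "y \<notin> cube w (\<rho> div 2)" "outside w \<rho> y \<subset> outside w \<rho> x" by auto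
qed

text \<open>Stated for an arbitrary \<open>J\<close> containing the coordinates outside the inner
  cube; later \<open>J\<close> is the complement of the coordinates fixed in the first
  phase.\<close>

lemma no_spread_events:
  assumes "n \<le> \<rho> div 2" "\<And>y. y \<notin> cube w (\<rho> div 2) \<Longrightarrow> Number y \<in> J"
    "\<And>y m. y \<notin> cube w (\<rho> div 2) \<Longrightarrow> Increment (y, 1) m \<in> J"
  shows "no_spread n \<rho> \<in> sets (sub J)"
  unfolding no_spread_def
proof (intro sets.finite_UN ballI)
  fix x assume x: "x \<in> cube w (Suc \<rho>) - cube w \<rho>"
  have "{\<omega> \<in> space (sub J). \<forall>y\<in>targets n x (exit_axis \<rho> x). \<omega> \<in> space M - hit n x y} \<in> sets (sub J)"
  proof (intro sets.sets_Collect_finite_All finite_targets)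
    fix y assume "y \<in> targets n x (exit_axis \<rho> x)"
    then have "y \<notin> cube w (\<rho> div 2)" using targets_location[OF x assms(1)] by blast
    then have "hit n x y \<in> sets (sub J)" using assms by (intro hit_events) auto
    then have "space (sub J) - hit n x y \<in> sets (sub J)" by (rule sets.compl_sets)
    moreover have "{\<omega> \<in> space (sub J). \<omega> \<in> space M - hit n x y} = space (sub J) - hit n x y" by auto
    ultimately show "{\<omega> \<in> space (sub J). \<omega> \<in> space M - hit n x y} \<in> sets (sub J)" by simp
  qed
  then show "{\<omega> \<in> space M. \<forall>y\<in>targets n x (exit_axis \<rho> x). \<omega> \<in> space M - hit n x y} \<in> sets (sub J)"
    by (simp only: space_sub)
qed simp

lemma prob_no_spread:
  "prob (no_spread n \<rho>) \<le> real ((2 * \<rho> + 3) ^ CARD('d)) * exp (- (hit_const * sqrt (real n)))"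
proof -
  have "prob (no_spread n \<rho>) \<le> (\<Sum>x\<in>cube w (Suc \<rho>) - cube w \<rho>.
      prob {\<omega> \<in> space M. \<forall>y\<in>targets n x (exit_axis \<rho> x). \<omega> \<in> space M - hit n x y})"
    unfolding no_spread_def
  proof (intro finite_measure_subadditive_finite, simp, clarify)
    fix x
    have "hit n x y \<in> events" for y using hit_events[of y UNIV n x] sets_sub_subset by blast
    then show "{\<omega> \<in> space M. \<forall>y\<in>targets n x (exit_axis \<rho> x). \<omega> \<in> space M - hit n x y} \<in> events"
      by (intro sets.sets_Collect_finite_All) auto
  qed
  also have "\<dots> \<le> (\<Sum>x\<in>cube w (Suc \<rho>) - cube w \<rho>. exp (- (hit_const * sqrt (real n))))"
    by (intro sum_mono prob_no_hit)
  also have "\<dots> = real (card (cube w (Suc \<rho>) - cube w \<rho>)) * exp (- (hit_const * sqrt (real n)))" by simp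
  also have "\<dots> \<le> real ((2 * \<rho> + 3) ^ CARD('d)) * exp (- (hit_const * sqrt (real n)))"
  proof (intro mult_right_mono of_nat_mono)
    have "card (cube w (Suc \<rho>) - cube w \<rho>) \<le> card (cube w (Suc \<rho>))" by (intro card_mono) auto
    also have "\<dots> \<le> (2 * \<rho> + 3) ^ CARD('d)" using card_cube_le[of w "Suc \<rho>"] by (simp add: numeral_3_eq_3)
    finally show "card (cube w (Suc \<rho>) - cube w \<rho>) \<le> (2 * \<rho> + 3) ^ CARD('d)" .
  qed simp
  finally show ?thesis .
qed

lemma wait_events:
  assumes "Wait q m k \<in> J"
  shows "{\<omega> \<in> space M. obs r (Wait q m k) \<omega> = 0} \<in> sets (sub J)"
  using measurable_sets[OF measurable_sub[OF assms], of "{0}"]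
  by (simp add: vimage_def Int_def conj_commute)

lemma all_wait_events:
  assumes "\<And>k. Wait q m k \<in> J"
  shows "{\<omega> \<in> space M. \<forall>k\<in>{1..K}. obs r (Wait q m k) \<omega> = 0} \<in> sets (sub J)"
proof -
  have "{\<omega> \<in> space (sub J). \<forall>k\<in>{1..K}. obs r (Wait q m k) \<omega> = 0} \<in> sets (sub J)"
    using wait_events[OF assms] by (intro sets.sets_Collect_finite_All) auto
  then show ?thesis by (simp only: space_sub)
qed

lemma slow_events:
  assumes "\<And>y m k. y \<notin> cube w (\<rho> div 2) \<Longrightarrow> Wait (y, 1) m k \<in> J"
  shows "slow n K \<rho> \<in> sets (sub J)"
  unfolding slow_def using assms by (intro sets.finite_UN all_wait_events) auto

lemma prob_slow: "prob (slow n K \<rho>) \<le> real ((2 * \<rho> + 3) ^ CARD('d)) * real n * (1 - r) ^ K"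
proof -
  let ?A = "\<lambda>y m. {\<omega> \<in> space M. \<forall>k\<in>{1..K}. obs r (Wait (y, 1) m k) \<omega> = 0}"
  let ?D = "cube w (Suc \<rho>) - cube w (\<rho> div 2)"
  have ev: "?A y m \<in> events" for y m using all_wait_events[of "(y, 1)" m UNIV K] sets_sub_subset by blast
  have A: "prob (?A y m) = (1 - r) ^ K" for y m
  proof -
    have "prob (?A y m) = prob {\<omega> \<in> space M. \<forall>c\<in>Wait (y, 1) m ` {1..K}. obs r c \<omega> \<in> {0}}" by simp
    also have "\<dots> = (\<Prod>c\<in>Wait (y, 1) m ` {1..K}. measure_pmf.prob (obs_law \<nu> r c) {0})"
      by (rule obs_probs) simp
    also have "\<dots> = (\<Prod>k\<in>{1..K}. measure_pmf.prob (map_pmf of_bool (bernoulli_pmf r)) {0 :: nat})"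
      by (subst prod.reindex) (auto simp: inj_on_def obs_law_def)
    also have "of_bool -` {0 :: nat} = {False}" by auto
    then have "measure_pmf.prob (map_pmf of_bool (bernoulli_pmf r)) {0 :: nat} = 1 - r"
      unfolding measure_map_pmf using r by (simp add: measure_pmf_single)
    finally show ?thesis by simp
  qed
  have "prob (slow n K \<rho>) \<le> (\<Sum>y\<in>?D. prob (\<Union>m\<in>{..<n}. ?A y m))"
    unfolding slow_def using ev by (intro finite_measure_subadditive_finite) auto
  also have "\<dots> \<le> (\<Sum>y\<in>?D. \<Sum>m<n. prob (?A y m))"
    using ev by (intro sum_mono finite_measure_subadditive_finite) auto
  also have "\<dots> = real (card ?D) * real n * (1 - r) ^ K"
    by (simp only: A) simp
  also have "\<dots> \<le> real ((2 * \<rho> + 3) ^ CARD('d)) * real n * (1 - r) ^ K"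
  proof (intro mult_right_mono of_nat_mono)
    have "card ?D \<le> card (cube w (Suc \<rho>))" by (intro card_mono) auto
    also have "\<dots> \<le> (2 * \<rho> + 3) ^ CARD('d)" using card_cube_le[of w "Suc \<rho>"] by (simp add: numeral_3_eq_3)
    finally show "card ?D \<le> (2 * \<rho> + 3) ^ CARD('d)" .
  qed (use r in auto)
  finally show ?thesis .
qed

lemma escape_events:
  assumes "finite P" "\<And>q k. q \<in> P \<Longrightarrow> Increment q (s + k) \<in> J"
  shows "escape P s B \<rho> \<in> sets (sub J)"
  unfolding escape_def using assms by (intro sets.finite_UN block_events) auto

lemma prob_escape:
  assumes "finite P" "0 \<le> t" "t \<le> 1"
  shows "prob (escape P s B \<rho>)
    \<le> real (card P) * (real B + 1) * real CARD('d) * (2 * exp (t\<^sup>2 * real B - t * (real \<rho> / 2)))"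
proof -
  let ?A = "\<lambda>q k a. {\<omega> \<in> space M. real \<rho> / 2 \<le> \<bar>real_of_int (sum_list (block q s k \<omega>) $ a)\<bar>}"
  let ?e = "2 * exp (t\<^sup>2 * real B - t * (real \<rho> / 2))"
  have ev: "?A q k a \<in> events" for q k a
    using block_events[of k q s UNIV "\<lambda>xs. real \<rho> / 2 \<le> \<bar>real_of_int (sum_list xs $ a)\<bar>"]
      sets_sub_subset by blast
  have ev2: "(\<Union>a\<in>UNIV. ?A q k a) \<in> events" for q k
    by (intro sets.finite_UN ev finite)
  have ev3: "(\<Union>k\<in>{..B}. \<Union>a\<in>UNIV. ?A q k a) \<in> events" for q
    by (intro sets.finite_UN ev2 finite_atMost)
  have "prob (escape P s B \<rho>) \<le> (\<Sum>q\<in>P. prob (\<Union>k\<in>{..B}. \<Union>a\<in>UNIV. ?A q k a))"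
    unfolding escape_def by (intro finite_measure_subadditive_finite image_subsetI ev3 assms(1))
  also have "\<dots> \<le> (\<Sum>q\<in>P. \<Sum>k\<le>B. prob (\<Union>a\<in>UNIV. ?A q k a))"
    by (intro sum_mono finite_measure_subadditive_finite image_subsetI ev2 finite_atMost)
  also have "\<dots> \<le> (\<Sum>q\<in>P. \<Sum>k\<le>B. \<Sum>a\<in>UNIV. prob (?A q k a))"
    by (intro sum_mono finite_measure_subadditive_finite image_subsetI ev finite)
  also have "\<dots> \<le> (\<Sum>q\<in>P. \<Sum>k\<le>B. \<Sum>a\<in>(UNIV :: 'd set). ?e)"
  proof (intro sum_mono)
    fix q k and a :: 'd assume k: "k \<in> {..B}"
    have "prob (?A q k a) \<le> 2 * exp (t\<^sup>2 * real k - t * (real \<rho> / 2))"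
      using walk_mean_deviation[OF assms(2,3), of k "real \<rho> / 2" a]
        prob_block[of "\<lambda>xs. real \<rho> / 2 \<le> \<bar>real_of_int (sum_list xs $ a)\<bar>" q s k] by simp
    also have "\<dots> \<le> ?e" using k by (simp add: mult_left_mono)
    finally show "prob (?A q k a) \<le> ?e" .
  qed
  also have "\<dots> = real (card P) * (real B + 1) * real CARD('d) * ?e" by (simp add: add.commute)
  finally show ?thesis .
qed

section \<open>Cylinders of positive probability\<close>

lemma cylinder_pos:
  assumes "finite J" "\<And>c. c \<in> J \<Longrightarrow> f c \<in> set_pmf (obs_law \<nu> r c)"
  shows "0 < prob {\<omega> \<in> space M. \<forall>c\<in>J. obs r c \<omega> = f c}"
proof -
  have "0 < (\<Prod>c\<in>J. measure_pmf.prob (obs_law \<nu> r c) {f c})"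
    using assms(2) by (intro prod_pos) (simp add: measure_pmf_single pmf_positive)
  also have "\<dots> = prob {\<omega> \<in> space M. \<forall>c\<in>J. obs r c \<omega> \<in> {f c}}"
    by (rule obs_probs[OF assms(1), symmetric])
  finally show ?thesis by simp
qed

lemma cylinder_events:
  assumes "finite J" "J \<subseteq> J'"
  shows "{\<omega> \<in> space M. \<forall>c\<in>J. obs r c \<omega> = f c} \<in> sets (sub J')"
proof -
  have "{\<omega> \<in> space (sub J'). \<forall>c\<in>J. obs r c \<omega> = f c} \<in> sets (sub J')"
  proof (intro sets.sets_Collect_finite_All assms)
    fix c assume "c \<in> J"
    with assms(2) have "c \<in> J'" by blast
    from measurable_sets[OF measurable_sub[OF this], of "{f c}"]
    show "{\<omega> \<in> space (sub J'). obs r c \<omega> = f c} \<in> sets (sub J')"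
      by (simp add: vimage_def Int_def conj_commute)
  qed
  then show ?thesis by (simp only: space_sub)
qed

end

section \<open>Positive probability of winning\<close>

definition jumps :: "nat \<Rightarrow> nat" where
  "jumps \<rho> = nat \<lfloor>sqrt (real \<rho>)\<rfloor>"

definition patience :: "nat \<Rightarrow> nat" where
  "patience \<rho> = nat \<lfloor>real \<rho> powr (1/8)\<rfloor>"

text \<open>Bounds the total length of the stages up to radius \<open>\<rho>\<close> by
  \<open>\<rho> + 1\<close> copies of the longest one; \<open>d\<close> stands for the
  dimension.\<close>

definition horizon :: "nat \<Rightarrow> nat \<Rightarrow> nat" where
  "horizon d \<rho> = (\<rho> + 1) * (d * (jumps \<rho> * patience \<rho>))"

lemma jumps_mono: "\<rho> \<le> \<sigma> \<Longrightarrow> jumps \<rho> \<le> jumps \<sigma>"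
  unfolding jumps_def by (intro nat_mono floor_mono) simp

lemma patience_mono: "\<rho> \<le> \<sigma> \<Longrightarrow> patience \<rho> \<le> patience \<sigma>"
  unfolding patience_def by (intro nat_mono floor_mono powr_mono2) auto

lemma jumps_patience_pos: "1 \<le> \<rho> \<Longrightarrow> 1 \<le> jumps \<rho> * patience \<rho>"
proof -
  assume "1 \<le> \<rho>"
  then have "jumps 1 \<le> jumps \<rho>" "patience 1 \<le> patience \<rho>"
    using jumps_mono patience_mono by blast+
  moreover have "jumps 1 = 1" "patience 1 = 1" by (simp_all add: jumps_def patience_def)
  ultimately show ?thesis by (metis mult_le_mono mult_1)
qed

lemma jumps_le_half: "4 \<le> \<rho> \<Longrightarrow> jumps \<rho> \<le> \<rho> div 2"
proof -
  assume "4 \<le> \<rho>"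
  then have "2 \<le> sqrt (real \<rho>)" using real_sqrt_le_mono[of 4 "real \<rho>"] by simp
  then have "2 * sqrt (real \<rho>) \<le> sqrt (real \<rho>) * sqrt (real \<rho>)" by (intro mult_right_mono) auto
  then have "2 * sqrt (real \<rho>) \<le> real \<rho>" by simp
  moreover have "real (jumps \<rho>) \<le> sqrt (real \<rho>)" by (simp add: jumps_def)
  ultimately have "real (2 * jumps \<rho>) \<le> real \<rho>" by simp
  then show ?thesis by linarith
qed

lemma sum_stages_le_horizon:
  "(\<Sum>r=R..\<rho>. d * (jumps r * patience r)) \<le> horizon d \<rho>"
proof -
  have "(\<Sum>r=R..\<rho>. d * (jumps r * patience r)) \<le> (\<Sum>r=R..\<rho>. d * (jumps \<rho> * patience \<rho>))"
    by (intro sum_mono mult_le_mono jumps_mono patience_mono) auto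
  also have "\<dots> = (Suc \<rho> - R) * (d * (jumps \<rho> * patience \<rho>))" by simp
  also have "\<dots> \<le> horizon d \<rho>" unfolding horizon_def by (intro mult_right_mono) auto
  finally show ?thesis .
qed

lemma summable_if_bigo_inverse_square:
  assumes "f \<in> O(\<lambda>n. 1 / (real n)\<^sup>2)"
  shows "summable (f :: nat \<Rightarrow> real)"
proof (rule summable_comparison_test_bigo[OF _ assms])
  show "summable (\<lambda>n. norm (1 / (real n)\<^sup>2))"
    using inverse_power_summable[of 2, where 'a = real] by (simp add: inverse_eq_divide)
qed

context frog_estimates
begin

definition bad :: "'d particle set \<Rightarrow> nat \<Rightarrow> nat \<Rightarrow> ('d, 'u) sample set" where
  "bad P s \<rho> = no_spread (jumps \<rho>) \<rho> \<union> slow (jumps \<rho>) (patience \<rho>) \<rho> \<union> escape P s (horizon CARD('d) \<rho>) \<rho>"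

lemma bad_events:
  assumes "finite P" "4 \<le> \<rho>" "\<And>y. y \<notin> cube w (\<rho> div 2) \<Longrightarrow> Number y \<in> J"
    "\<And>y m. y \<notin> cube w (\<rho> div 2) \<Longrightarrow> Increment (y, 1) m \<in> J"
    "\<And>y m k. y \<notin> cube w (\<rho> div 2) \<Longrightarrow> Wait (y, 1) m k \<in> J"
    "\<And>q k. q \<in> P \<Longrightarrow> Increment q (s + k) \<in> J"
  shows "bad P s \<rho> \<in> sets (sub J)"
  unfolding bad_def
  by (intro sets.Un no_spread_events slow_events escape_events jumps_le_half assms; assumption)

lemma not_escapeD:
  assumes "\<omega> \<in> space M" "\<omega> \<notin> escape P s B \<rho>" "q \<in> P" "k \<le> B"
  shows "\<bar>real_of_int (sum_list (block q s k \<omega>) $ a)\<bar> < real \<rho> / 2"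
proof (rule ccontr)
  assume "\<not> ?thesis"
  then have "\<omega> \<in> {\<omega> \<in> space M. real \<rho> / 2 \<le> \<bar>real_of_int (sum_list (block q s k \<omega>) $ a)\<bar>}"
    using assms(1) by simp
  then have "\<omega> \<in> escape P s B \<rho>"
    unfolding escape_def using assms(3,4) by blast
  with assms(2) show False by blast
qed

text \<open>The radius is chosen uniformly in the offset \<open>s\<close>, which is possible because
  the increments are identically distributed. This order of quantifiers is essential: the offset
  will be the length of a walk covering the cube of radius \<open>R\<close>, known only once
  \<open>R\<close> is.\<close>

lemma ex_good_radius:
  assumes "0 < occupation" "finite P" "P \<noteq> {}"
  shows "\<exists>R\<ge>R'. \<forall>s. 0 < prob (space M - (\<Union>k. bad P s (k + R)))"
proof -
  define b1 where "b1 \<rho> = real ((2 * \<rho> + 3) ^ CARD('d)) * exp (- (hit_const * sqrt (real (jumps \<rho>))))" for \<rho>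
  \<comment> \<open>The factor \<open>(1 - r) ^ K\<close> is replaced by
    \<open>exp (- r * K)\<close>, which treats \<open>r = 1\<close> along with the other
    values.\<close>
  define b2 where "b2 \<rho> = real ((2 * \<rho> + 3) ^ CARD('d)) * real (jumps \<rho>) * exp (- (r * real (patience \<rho>)))" for \<rho>
  \<comment> \<open>\<open>(t \<rho>)\<^sup>2 * horizon\<close> stays bounded because \<open>horizon = O(\<rho> powr (13/8))\<close>, while
    \<open>t \<rho> * \<rho> = \<rho> powr (1/8)\<close> tends to infinity.\<close>
  define t where "t \<rho> = real \<rho> powr (- 7/8)" for \<rho>
  define b3 where "b3 \<rho> = real (card P) * (real (horizon CARD('d) \<rho>) + 1) * real CARD('d)
      * (2 * exp ((t \<rho>)\<^sup>2 * real (horizon CARD('d) \<rho>) - t \<rho> * (real \<rho> / 2)))" for \<rho>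
  have "0 < hit_const" using assms(1) by (simp add: hit_const_def)
  then have "b1 \<in> O(\<lambda>\<rho>. 1 / (real \<rho>)\<^sup>2)"
    unfolding b1_def jumps_def by real_asymp
  moreover have "b2 \<in> O(\<lambda>\<rho>. 1 / (real \<rho>)\<^sup>2)"
    unfolding b2_def jumps_def patience_def using r by real_asymp
  moreover have "b3 \<in> O(\<lambda>\<rho>. 1 / (real \<rho>)\<^sup>2)"
  proof -
    have "0 < card P" using assms by (simp add: card_gt_0_iff)
    then show ?thesis unfolding b3_def t_def horizon_def jumps_def patience_def by real_asymp
  qed
  ultimately have "summable (\<lambda>\<rho>. b1 \<rho> + b2 \<rho> + b3 \<rho>)"
    by (intro summable_add summable_if_bigo_inverse_square)
  from suminf_exist_split[OF zero_less_one this] obtain R0 where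
    R0: "\<And>n. n \<ge> R0 \<Longrightarrow> norm (\<Sum>k. b1 (k + n) + b2 (k + n) + b3 (k + n)) < 1" by blast
  \<comment> \<open>\<open>R0\<close> makes the tail of the series less than 1, and 4 is the
    threshold of \<open>jumps_le_half\<close>.\<close>
  define R where "R = max R' (max R0 4)"
  have summ: "summable (\<lambda>k. b1 (k + R) + b2 (k + R) + b3 (k + R))"
    using \<open>summable (\<lambda>\<rho>. b1 \<rho> + b2 \<rho> + b3 \<rho>)\<close>
    by (subst summable_iff_shift[of "\<lambda>\<rho>. b1 \<rho> + b2 \<rho> + b3 \<rho>" R])
  have bad: "bad P s \<rho> \<in> events" "prob (bad P s \<rho>) \<le> b1 \<rho> + b2 \<rho> + b3 \<rho>" if "R \<le> \<rho>" for s \<rho>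
  proof -
    have \<rho>: "4 \<le> \<rho>" using that by (simp add: R_def)
    show "bad P s \<rho> \<in> events"
      using bad_events[OF assms(2) \<rho>, of UNIV s] sets_sub_subset by blast
    let ?A = "no_spread (jumps \<rho>) \<rho>" and ?B = "slow (jumps \<rho>) (patience \<rho>) \<rho>"
      and ?C = "escape P s (horizon CARD('d) \<rho>) \<rho>"
    have ev: "?A \<in> events" "?B \<in> events" "?C \<in> events"
      using no_spread_events[OF jumps_le_half[OF \<rho>], of UNIV] slow_events[of \<rho> UNIV]
        escape_events[OF assms(2), of s UNIV] sets_sub_subset by blast+
    have "prob (bad P s \<rho>) \<le> prob ?A + prob ?B + prob ?C"
    proof -
      have "prob (?A \<union> ?B \<union> ?C) \<le> prob (?A \<union> ?B) + prob ?C"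
        by (intro measure_Un_le sets.Un ev)
      with measure_Un_le[OF ev(1,2)] show ?thesis unfolding bad_def by linarith
    qed
    also have "prob ?A \<le> b1 \<rho>" unfolding b1_def by (rule prob_no_spread)
    also have "prob ?B \<le> b2 \<rho>"
    proof -
      have "(1 - r) ^ patience \<rho> \<le> exp (- r) ^ patience \<rho>"
        using exp_ge_add_one_self[of "- r"] r by (intro power_mono) auto
      also have "\<dots> = exp (- (r * real (patience \<rho>)))"
        by (simp add: exp_of_nat_mult[symmetric] mult.commute)
      finally have "real ((2 * \<rho> + 3) ^ CARD('d)) * real (jumps \<rho>) * (1 - r) ^ patience \<rho> \<le> b2 \<rho>"
        unfolding b2_def by (intro mult_left_mono) auto
      with prob_slow[of "jumps \<rho>" "patience \<rho>" \<rho>] show ?thesis by linarith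
    qed
    also have "prob ?C \<le> b3 \<rho>"
      unfolding b3_def
    proof (rule prob_escape[OF assms(2)])
      show "t \<rho> \<le> 1" using \<rho> unfolding t_def using powr_mono[of "- 7/8" 0 "real \<rho>"] by simp
    qed (simp add: t_def)
    finally show "prob (bad P s \<rho>) \<le> b1 \<rho> + b2 \<rho> + b3 \<rho>" by simp
  qed
  have "0 < prob (space M - (\<Union>k. bad P s (k + R)))" for s
  proof -
    have summ': "summable (\<lambda>k. prob (bad P s (k + R)))"
      by (rule summable_comparison_test'[OF summ, of 0]) (use bad in auto)
    have "prob (\<Union>k. bad P s (k + R)) \<le> (\<Sum>k. prob (bad P s (k + R)))"
      by (intro finite_measure_subadditive_countably summ') (use bad in auto)
    also have "\<dots> \<le> (\<Sum>k. b1 (k + R) + b2 (k + R) + b3 (k + R))"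
      by (intro suminf_le summ summ' bad) auto
    also have "\<dots> < 1"
    proof -
      have "R0 \<le> R" by (simp add: R_def)
      from R0[OF this] show ?thesis by (simp add: abs_less_iff)
    qed
    finally show ?thesis using bad by (subst prob_compl) auto
  qed
  moreover have "R' \<le> R" by (simp add: R_def)
  ultimately show ?thesis by blast
qed

end

section \<open>Combining both events and transferring them to the process\<close>

lemma frog_process_0: "frog_process p tie z \<omega> 0 = initial_config (fst \<omega>) z"
  by (cases \<omega>) (simp add: frog_process_def)

lemma frog_process_Suc:
  "frog_process p tie z \<omega> (Suc t) =
    activate_config (tie (snd (snd (snd \<omega>))) t (frog_history p tie z \<omega> t)
        (move_config p (fst (snd \<omega>)) (fst (snd (snd \<omega>))) (frog_process p tie z \<omega> t)))
      (move_config p (fst (snd \<omega>)) (fst (snd (snd \<omega>))) (frog_process p tie z \<omega> t))"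
  by (simp add: frog_process_def frog_history_Suc Let_def)

lemma ex_cube: "\<exists>\<rho>. x \<in> cube (w :: int ^ 'd::finite) \<rho>"
proof
  show "x \<in> cube w (\<Sum>j\<in>UNIV. nat \<bar>x $ j - w $ j\<bar>)"
    unfolding cube_def mem_Collect_eq
  proof
    fix j
    have "nat \<bar>x $ j - w $ j\<bar> \<le> (\<Sum>j\<in>UNIV. nat \<bar>x $ j - w $ j\<bar>)"
      by (rule member_le_sum) auto
    then show "\<bar>x $ j - w $ j\<bar> \<le> int (\<Sum>j\<in>UNIV. nat \<bar>x $ j - w $ j\<bar>)" by linarith
  qed
qed

text \<open>Of two opposite neighbours of \<open>l\<close> at most one equals \<open>w\<close>; this
  works in dimension one as well.\<close>

lemma ex_unit_step_avoiding: "\<exists>e\<in>unit_steps. - e \<in> unit_steps \<and> l + e \<noteq> (w :: int ^ 'd::finite)"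
proof -
  let ?e = "axis undefined 1 :: int ^ 'd"
  have neg: "- ?e = axis undefined (- 1)" by (simp add: vec_eq_iff axis_def)
  have "?e \<in> unit_steps" "- ?e \<in> unit_steps" unfolding neg by (auto simp: unit_steps_def)
  moreover have "?e \<noteq> - ?e" unfolding neg by (simp add: axis_eq_axis)
  then have "l + ?e \<noteq> w \<or> l + - ?e \<noteq> w" by (metis add_left_cancel)
  ultimately show ?thesis by (metis minus_minus)
qed

lemma alternating_walk:
  assumes "\<And>k. k < m \<Longrightarrow> S (q, k) = (if even k then u else - u)"
  shows "walk_path S q m = (if even m then fst q else fst q + u)"
  using assms
proof (induction m)
  case (Suc m)
  have "walk_path S q (Suc m) = walk_path S q m + S (q, m)" by (simp add: walk_path_def add.assoc)
  with Suc show ?case by simp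
qed (simp add: walk_path_def)

lemma abs_add_diff_le: "2 * \<bar>u\<bar> < r \<Longrightarrow> 2 * \<bar>v - c\<bar> \<le> r \<Longrightarrow> \<bar>v + u - c\<bar> \<le> r" for u v c r :: int
  by (auto simp: abs_if split: if_splits)

text \<open>\<open>E\<close> prescribes finitely many coordinates for the first phase,
  \<open>G\<close> excludes all later failures, and the two are independent with positive
  probability. On their intersection every assumption of \<open>frog_win\<close> holds, whatever the
  tie-breaking rule.\<close>

lemma winning_probability_pos:
  fixes \<nu> :: "nat pmf" and N :: "'u measure" and tie :: "('d::finite, 'u) tie_rule"
    and p :: "frog_type \<Rightarrow> real" and z w l :: "int ^ 'd"
  assumes \<nu>: "0 < measure_pmf.prob \<nu> {1..}" and p: "0 < p i" "p i \<le> 1"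
    and N: "prob_space N" and tie: "tie_breaking_rule N tie"
    and z: "z \<noteq> 0" and wl: "w = 0 \<and> l = z \<and> i = Type1 \<or> w = z \<and> l = 0 \<and> i = Type2"
  shows "0 < measure (frog_space \<nu> N) {\<omega> \<in> space (frog_space \<nu> N).
      (infinite_growth p tie z i \<omega> \<and> \<not> infinite_growth p tie z (other_type i) \<omega>)
      \<and> 1 \<le> initial_number \<omega> 0 \<and> 1 \<le> initial_number \<omega> z}"
proof -
  interpret frog_estimates \<nu> N "p i" w by (rule frog_estimates.intro[OF N p])
  have "w \<noteq> l" using wl z by auto
  \<comment> \<open>A positive atom of \<open>\<nu>\<close>. Prescribing exactly \<open>m0\<close>
    particles at \<open>l\<close> and \<open>l'\<close> makes the set \<open>P\<close> of potential
    losers finite and deterministic.\<close>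
  obtain m0 where m0: "1 \<le> m0" "m0 \<in> set_pmf \<nu>"
  proof -
    have "{1..} \<inter> set_pmf \<nu> \<noteq> {}"
      using \<nu> by (metis less_irrefl measure_Int_set_pmf measure_empty)
    then show ?thesis using that by auto
  qed
  obtain e where e: "e \<in> unit_steps" "- e \<in> unit_steps" "l + e \<noteq> w"
    using ex_unit_step_avoiding by blast
  define l' where "l' = l + e"
  have "l' \<noteq> l" using e(1) by (auto simp: l'_def unit_steps_def axis_eq_0_iff)
  have "l' \<noteq> w" using e(3) by (simp add: l'_def)
  define P where "P = {l, l'} \<times> {1..m0}"
  have P: "finite P" "P \<noteq> {}" using m0 by (auto simp: P_def)
  obtain \<rho>1 \<rho>2 where \<rho>12: "l \<in> cube w \<rho>1" "l' \<in> cube w \<rho>2" using ex_cube by metis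
  have "0 < occupation" using \<nu> by (simp add: occupation_def)
  from ex_good_radius[OF this P, of "2 * max \<rho>1 \<rho>2 + 4"] obtain R where
    R: "2 * max \<rho>1 \<rho>2 + 4 \<le> R" and good: "\<And>s. 0 < prob (space M - (\<Union>k. bad P s (k + R)))" by blast
  have "\<rho>1 \<le> R div 2" "\<rho>2 \<le> R div 2" "4 \<le> R" using R by auto
  then have l_cube: "l \<in> cube w (R div 2)" "l' \<in> cube w (R div 2)"
    using \<rho>12 cube_mono by blast+
  have w_cube: "w \<in> cube w (R div 2)" by (simp add: cube_def)
  have "finite ((\<lambda>x. x - w) ` cube w R)" by simp
  from ex_covering_walk[OF this] obtain xs where
    xs: "set xs \<subseteq> unit_steps" "(\<lambda>x. x - w) ` cube w R \<subseteq> visited xs" by blast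
  define M0 where "M0 = length xs"
  define Je where "Je = Number ` {w, l, l'} \<union> (\<lambda>(q, m). Increment q m) ` (insert (w, 1) P \<times> {..<M0})
    \<union> (\<lambda>m. Wait (w, 1) m 1) ` {..<M0}"
  \<comment> \<open>The first particle of \<open>w\<close> follows the covering walk
    \<open>xs\<close> without waiting (the value 1 means \<open>L \<le> p i\<close>). Particles from
    \<open>l\<close> alternate between the steps \<open>e\<close> and \<open>- e\<close>, those from
    \<open>l'\<close> in the opposite order.\<close>
  define f where "f c = (case c of Number y \<Rightarrow> m0
    | Increment q m \<Rightarrow> to_nat (if fst q = w then xs ! m
        else if fst q = l then if even m then e else - e else if even m then - e else e)
    | Wait q m k \<Rightarrow> 1)" for c :: "'d coord"
  define E where "E = {\<omega> \<in> space M. \<forall>c\<in>Je. obs (p i) c \<omega> = f c}"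
  define G where "G = space M - (\<Union>k. bad P M0 (k + R))"
  have "finite Je" unfolding Je_def using P(1) by blast
  have nth_xs: "xs ! m \<in> unit_steps" if "m < length xs" for m using xs(1) that by auto
  have True_pmf: "True \<in> set_pmf (bernoulli_pmf (p i))" using p by (simp add: set_pmf_iff)
  have "0 < prob E"
    unfolding E_def
  proof (rule cylinder_pos[OF \<open>finite Je\<close>])
    fix c assume "c \<in> Je"
    then show "f c \<in> set_pmf (obs_law \<nu> (p i) c)"
      unfolding Je_def using m0(2) e(1,2)
      by (auto simp: f_def obs_law_def M0_def intro!: imageI nth_xs image_eqI[OF _ True_pmf])
  qed
  moreover have "prob (E \<inter> G) = prob E * prob G"
  proof (rule prob_Int_blocks)
    show "Je \<inter> - Je = {}" by simp
    show "E \<in> sets (sub Je)" unfolding E_def by (rule cylinder_events[OF \<open>finite Je\<close> order_refl])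
    have "bad P M0 (k + R) \<in> sets (sub (- Je))" for k
    proof (rule bad_events[OF P(1)])
      \<comment> \<open>The radii are at least \<open>R\<close>, so half of each covers
        \<open>w\<close>, \<open>l\<close> and \<open>l'\<close>, where all coordinates of
        \<open>Je\<close> are based.\<close>
      have far: "y \<notin> {w, l, l'}" if "y \<notin> cube w ((k + R) div 2)" for y
        using that l_cube w_cube cube_mono[of "R div 2" "(k + R) div 2" w] by (auto simp: div_le_mono)
      show "4 \<le> k + R" using \<open>4 \<le> R\<close> by simp
      show "Number y \<in> - Je" if "y \<notin> cube w ((k + R) div 2)" for y
        using far[OF that] by (auto simp: Je_def)
      show "Increment (y, 1) m \<in> - Je" if "y \<notin> cube w ((k + R) div 2)" for y m
        using far[OF that] by (auto simp: Je_def P_def)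
      show "Wait (y, 1) m j \<in> - Je" if "y \<notin> cube w ((k + R) div 2)" for y m j
        using far[OF that] by (auto simp: Je_def)
      \<comment> \<open>The losers share their particles with the first phase, but \<open>Je\<close>
        contains only increments with index below \<open>M0\<close>.\<close>
      show "Increment q (M0 + j) \<in> - Je" if "q \<in> P" for q j
        by (auto simp: Je_def)
    qed
    then have "space (sub (- Je)) - (\<Union>k. bad P M0 (k + R)) \<in> sets (sub (- Je))" by blast
    then show "G \<in> sets (sub (- Je))" by (simp add: G_def)
  qed
  ultimately have "0 < prob (E \<inter> G)" using good[of M0] by (simp add: G_def)
  also have "prob (E \<inter> G) \<le> prob {\<omega> \<in> space M.
      (infinite_growth p tie z i \<omega> \<and> \<not> infinite_growth p tie z (other_type i) \<omega>)
      \<and> 1 \<le> initial_number \<omega> 0 \<and> 1 \<le> initial_number \<omega> z}"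
  proof (rule finite_measure_mono)
    have num: "{\<omega> \<in> space M. 1 \<le> initial_number \<omega> y} \<in> events" for y
      using number_events[of y UNIV] sets_sub_subset
      by (auto simp: initial_number_def split_beta)
    have growth: "{\<omega> \<in> space M. infinite_growth p tie z j \<omega>} \<in> events" for j
      using measurable_infinite_growth[OF tie, of p z j \<nu>] by measurable
    show "{\<omega> \<in> space M.
      (infinite_growth p tie z i \<omega> \<and> \<not> infinite_growth p tie z (other_type i) \<omega>)
      \<and> 1 \<le> initial_number \<omega> 0 \<and> 1 \<le> initial_number \<omega> z} \<in> events"
      using num[of 0] num[of z] growth[of i] growth[of "other_type i"] by measurable
    show "E \<inter> G \<subseteq> {\<omega> \<in> space M.
      (infinite_growth p tie z i \<omega> \<and> \<not> infinite_growth p tie z (other_type i) \<omega>)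
      \<and> 1 \<le> initial_number \<omega> 0 \<and> 1 \<le> initial_number \<omega> z}"
    proof
      fix \<omega> assume \<omega>: "\<omega> \<in> E \<inter> G"
      let ?S = "fst (snd \<omega>)" and ?L = "fst (snd (snd \<omega>))"
      have space: "\<omega> \<in> space M" and coord: "\<And>c. c \<in> Je \<Longrightarrow> obs (p i) c \<omega> = f c"
        using \<omega> by (auto simp: E_def)
      have number: "fst \<omega> y = m0" if "y \<in> {w, l, l'}" for y
        using coord[of "Number y"] that by (auto simp: Je_def obs_def f_def)
      have step: "?S (q, m) = (if fst q = w then xs ! m
          else if fst q = l then if even m then e else - e else if even m then - e else e)"
        if "q \<in> insert (w, 1) P" "m < M0" for q m
      proof -
        have "Increment q m \<in> Je" using that unfolding Je_def by blast
        from coord[OF this] show ?thesis by (simp add: obs_def f_def)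
      qed
      have win_step: "?S ((w, 1), m) = xs ! m" if "m < M0" for m
        using step[OF insertI1 that] by simp
      have loser_path: "walk_path ?S q m \<in> {l, l'}" if "q \<in> P" "m \<le> M0" for q m
      proof -
        \<comment> \<open>The first step of the particle, directed towards the other of the two
          sites.\<close>
        define u where "u = (if fst q = l then e else - e)"
        have "fst q \<in> {l, l'}" using that by (auto simp: P_def)
        have "?S (q, k) = (if even k then u else - u)" if "k < m" for k
          using step[of q k] \<open>q \<in> P\<close> that \<open>m \<le> M0\<close> \<open>fst q \<in> {l, l'}\<close> \<open>w \<noteq> l\<close> \<open>l' \<noteq> w\<close>
          by (auto simp: u_def)
        from alternating_walk[of m ?S q u, OF this] \<open>fst q \<in> {l, l'}\<close> \<open>l' \<noteq> l\<close>
        show ?thesis by (auto simp: u_def l'_def)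
      qed
      have not_bad: "\<omega> \<notin> bad P M0 \<rho>" if "R \<le> \<rho>" for \<rho>
        using \<omega> le_Suc_ex[OF that] by (auto simp: G_def add.commute)
      interpret W: frog_win p ?S ?L "fst \<omega>" "frog_process p tie z \<omega>"
        "\<lambda>t. tie (snd (snd (snd \<omega>))) t (frog_history p tie z \<omega> t)
          (move_config p ?S ?L (frog_process p tie z \<omega> t))"
        w l i l' M0 R jumps patience
      proof
        show "frog_process p tie z \<omega> 0 = (\<lambda>(x, j). if 1 \<le> j \<and> j \<le> fst \<omega> x then
            (if x = w then Active i x 0 0 else if x = l then Active (other_type i) x 0 0 else Sleeping)
          else Absent)"
          unfolding frog_process_0 initial_config_def using wl z by (auto intro!: ext)
        show "w \<noteq> l" "w \<noteq> l'" using \<open>w \<noteq> l\<close> \<open>l' \<noteq> w\<close> by auto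
        show "1 \<le> fst \<omega> w" using number[of w] m0 by simp
        show "l \<in> cube w (R div 2)" "l' \<in> cube w (R div 2)" by (fact l_cube)+
        show "1 \<le> jumps \<rho> * patience \<rho>" if "R \<le> \<rho>" for \<rho>
          using jumps_patience_pos that \<open>4 \<le> R\<close> by simp
        show "?L ((w, 1), m, 1) \<le> p i" if "m < M0" for m
        proof -
          have "Wait (w, 1) m 1 \<in> Je" using that unfolding Je_def by blast
          from coord[OF this] show ?thesis by (simp add: obs_def f_def del: One_nat_def)
        qed
        show "\<exists>m\<le>M0. walk_path ?S (w, 1) m = x" if "x \<in> cube w R" for x
        proof -
          have "block (w, 1) 0 M0 \<omega> = xs"
          proof (rule nth_equalityI)
            fix m assume "m < length (block (w, 1) 0 M0 \<omega>)"
            then have "m < M0" by simp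
            then show "block (w, 1) 0 M0 \<omega> ! m = xs ! m" using win_step[of m] by (simp add: block_def)
          qed (simp add: M0_def)
          with xs(2) that have "x - w \<in> visited (block (w, 1) 0 M0 \<omega>)" by auto
          then show ?thesis unfolding visited_block by (auto simp: walk_path_def)
        qed
        show "walk_path ?S (x, j) m \<in> {l, l'}"
          if "x \<in> {l, l'}" "1 \<le> j" "j \<le> fst \<omega> x" "m \<le> M0" for x j m
          using that number[of x] by (intro loser_path) (auto simp: P_def)
        show "walk_path ?S (x, j) m \<in> cube w \<rho>"
          if late: "x \<in> {l, l'}" "1 \<le> j" "j \<le> fst \<omega> x" "R \<le> \<rho>" "M0 < m"
            "m \<le> M0 + (\<Sum>r=R..\<rho>. CARD('d) * (jumps r * patience r))" for x j m \<rho>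
        proof -
          have q: "(x, j) \<in> P" using late number[of x] by (auto simp: P_def)
          obtain k where k: "m = M0 + k" using late(5) less_imp_add_positive by blast
          have "k \<le> horizon CARD('d) \<rho>"
            using late(6) sum_stages_le_horizon[where d = "CARD('d)" and R = R and \<rho> = \<rho>] k by linarith
          then have small: "\<bar>real_of_int (sum_list (block (x, j) M0 k \<omega>) $ a)\<bar> < real \<rho> / 2" for a
            using not_bad[OF late(4)] by (intro not_escapeD[OF space _ q]) (auto simp: bad_def)
          have "walk_path ?S (x, j) M0 \<in> cube w (R div 2)"
            using loser_path[OF q order_refl] l_cube by auto
          then have near: "\<bar>walk_path ?S (x, j) M0 $ a - w $ a\<bar> \<le> int (R div 2)" for a
            by (simp add: cube_def)
          show ?thesis
            unfolding cube_def mem_Collect_eq k walk_path_split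
          proof
            fix a
            \<comment> \<open>Half the radius accounts for the displacement after \<open>M0\<close>
              jumps, the other half for the position reached by then.\<close>
            have "2 * \<bar>sum_list (block (x, j) M0 k \<omega>) $ a\<bar> < int \<rho>" using small[of a] by linarith
            moreover have "2 * (R div 2) \<le> \<rho>" using late(4) by simp
            then have "2 * int (R div 2) \<le> int \<rho>" by linarith
            then have "2 * \<bar>walk_path ?S (x, j) M0 $ a - w $ a\<bar> \<le> int \<rho>"
              using mult_left_mono[OF near[of a], of 2] by (rule order_trans[rotated]) simp
            ultimately show "\<bar>(walk_path ?S (x, j) M0 + sum_list (block (x, j) M0 k \<omega>)) $ a - w $ a\<bar> \<le> int \<rho>"
              unfolding vector_add_component by (rule abs_add_diff_le)
          qed
        qed
        show "\<exists>y m. y \<in> cube w (Suc \<rho>) \<and> y \<notin> cube w (\<rho> div 2) \<and> 1 \<le> fst \<omega> y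
            \<and> outside w \<rho> y \<subset> outside w \<rho> x \<and> m \<le> jumps \<rho> \<and> walk_path ?S (y, 1) m = x
            \<and> (\<forall>m<jumps \<rho>. \<exists>k\<in>{1..patience \<rho>}. ?L ((y, 1), m, k) \<le> p i)"
          if \<rho>: "R \<le> \<rho>" and x: "x \<in> cube w (Suc \<rho>)" "x \<notin> cube w \<rho>" for \<rho> x
        proof -
          have "\<omega> \<notin> no_spread (jumps \<rho>) \<rho>" "\<omega> \<notin> slow (jumps \<rho>) (patience \<rho>) \<rho>"
            using not_bad[OF \<rho>] by (auto simp: bad_def)
          note tail = this
          from tail(1) x space obtain y where
            y: "y \<in> targets (jumps \<rho>) x (exit_axis \<rho> x)" "\<omega> \<in> hit (jumps \<rho>) x y"
            unfolding no_spread_def by blast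
          have "4 \<le> \<rho>" using \<rho> \<open>4 \<le> R\<close> by simp
          from targets_location[OF _ jumps_le_half[OF this] y(1)] x
          have loc: "y \<in> cube w (Suc \<rho>)" "y \<notin> cube w (\<rho> div 2)" "outside w \<rho> y \<subset> outside w \<rho> x" by auto
          from y(2) have "1 \<le> fst \<omega> y" "x - y \<in> visited (block (y, 1) 0 (jumps \<rho>) \<omega>)"
            by (auto simp: hit_def)
          moreover from this(2) obtain m where "m \<le> jumps \<rho>" "walk_path ?S (y, 1) m = x"
            unfolding visited_block by (auto simp: walk_path_def)
          moreover have "\<exists>k\<in>{1..patience \<rho>}. ?L ((y, 1), m, k) \<le> p i" if "m < jumps \<rho>" for m
            using tail(2) that loc(1,2) space unfolding slow_def by (auto simp: obs_def)
          ultimately show ?thesis using loc by blast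
        qed
      qed (rule frog_process_Suc)
      have "infinite_growth p tie z i \<omega>" "\<not> infinite_growth p tie z (other_type i) \<omega>"
        using W.winner_infinite W.loser_finite by (simp_all add: infinite_growth_def activated_by_def)
      moreover have "1 \<le> initial_number \<omega> y" if "y \<in> {0, z}" for y
        using number[of y] m0 wl that by (auto simp: initial_number_def split_beta)
      ultimately show "\<omega> \<in> {\<omega> \<in> space M.
          (infinite_growth p tie z i \<omega> \<and> \<not> infinite_growth p tie z (other_type i) \<omega>)
          \<and> 1 \<le> initial_number \<omega> 0 \<and> 1 \<le> initial_number \<omega> z}"
        using space by simp
    qed
  qed
  finally show ?thesis .
qed

lemma (in prob_space) cond_prob_pos:
  assumes "0 < prob {\<omega> \<in> space M. P \<omega> \<and> Q \<omega>}" "{\<omega> \<in> space M. Q \<omega>} \<in> events"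
  shows "0 < \<P>(\<omega> in M. P \<omega> \<bar> Q \<omega>)"
proof -
  have "prob {\<omega> \<in> space M. P \<omega> \<and> Q \<omega>} \<le> prob {\<omega> \<in> space M. Q \<omega>}"
    using assms(2) by (intro finite_measure_mono) auto
  with assms(1) show ?thesis by (simp add: cond_prob_def)
qed

theorem proposition1p1:
  fixes \<nu> :: "nat pmf"
    and N :: "'u measure"
    and tie :: "('d::finite, 'u) tie_rule"
    and p :: "frog_type \<Rightarrow> real"
    and z :: "int ^ 'd"
  assumes "measure_pmf.prob \<nu> {m. m \<ge> 1} > 0"
    and "\<And>i. 0 < p i" and "\<And>i. p i \<le> 1"
    and "z \<noteq> 0"
    and "prob_space N"
    and "tie_breaking_rule N tie"
  shows "\<P>(\<omega> in frog_space \<nu> N.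
            infinite_growth p tie z Type1 \<omega> \<and> \<not> infinite_growth p tie z Type2 \<omega>
          \<bar> initial_number \<omega> 0 \<ge> 1 \<and> initial_number \<omega> z \<ge> 1) > 0
       \<and> \<P>(\<omega> in frog_space \<nu> N.
            \<not> infinite_growth p tie z Type1 \<omega> \<and> infinite_growth p tie z Type2 \<omega>
          \<bar> initial_number \<omega> 0 \<ge> 1 \<and> initial_number \<omega> z \<ge> 1) > 0"
proof -
  interpret F: prob_space "frog_space \<nu> N :: ('d, 'u) sample measure"
    by (rule prob_space_frog_space[OF assms(5)])
  let ?M = "frog_space \<nu> N :: ('d, 'u) sample measure"
  have \<nu>: "0 < measure_pmf.prob \<nu> {1..}" using assms(1) by (simp add: atLeast_def)
  have "{\<omega> \<in> space ?M. 1 \<le> initial_number \<omega> y} \<in> sets ?M" for y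
    using measurable_sets[OF measurable_initial_number[of y \<nu> N], of "{1..}"]
    by (simp add: initial_number_def split_beta vimage_def Int_def conj_commute)
  then have ev: "{\<omega> \<in> space ?M. 1 \<le> initial_number \<omega> 0 \<and> 1 \<le> initial_number \<omega> z} \<in> sets ?M"
    by (intro sets.sets_Collect_conj)
  have "0 < \<P>(\<omega> in ?M. infinite_growth p tie z Type1 \<omega> \<and> \<not> infinite_growth p tie z Type2 \<omega>
      \<bar> 1 \<le> initial_number \<omega> 0 \<and> 1 \<le> initial_number \<omega> z)"
    using winning_probability_pos[OF \<nu> assms(2,3,5,6,4), where i = Type1 and w = 0 and l = z] ev
    by (intro F.cond_prob_pos) auto
  moreover have "0 < \<P>(\<omega> in ?M. \<not> infinite_growth p tie z Type1 \<omega> \<and> infinite_growth p tie z Type2 \<omega>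
      \<bar> 1 \<le> initial_number \<omega> 0 \<and> 1 \<le> initial_number \<omega> z)"
    using winning_probability_pos[OF \<nu> assms(2,3,5,6,4), where i = Type2 and w = z and l = 0] ev
    by (intro F.cond_prob_pos) (auto simp: conj_commute)
  ultimately show ?thesis by blast
qed

end
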